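(* Let $f:[0,4]\to(-\infty,\infty]$ be a function finite and continuous on $(0,4]$ with $f(0)=\lim_{t\to0^+}f(t)$ and with the fourth derivative $f^{(4)}$ existing and convex on $(0,4)$. Then (i) the potential $p_f(\cdot,\overline\omega_{56})$ attains its absolute minimum over $\widetilde S^6$ at every point of $\overline\omega_{126}$; (ii) the potential $p_f(\cdot,\overline\omega_{126})$ attains its absolute minimum over $\widetilde S^6$ at every point of $\overline\omega_{56}$. If $f^{(4)}$ is strictly convex on $(0,4)$, then $p_f(\cdot,\overline\omega_{56})$ has no points of absolute minimum on $\widetilde S^6$ outside $\overline\omega_{126}$, and $p_f(\cdot,\overline\omega_{126})$ has no points of absolute minimum on $\widetilde S^6$ outside $\overline\omega_{56}$.
   Context: Let $\mathcal H=\{\mathbf x\in\mathbb R^8: x_1+\dots+x_8=0\}$ and $\widetilde S^6=S^7\cap\mathcal H$, a $6$-dimensional unit sphere (isometric to $S^6$). For finite $\omega=\{\mathbf x_1,\dots,\mathbf x_N\}\subset\widetilde S^6$, $p_f(\mathbf x,\omega)=\sum_{i=1}^N f(|\mathbf x-\mathbf x_i|^2)$. The kissing configuration $\overline\omega_{56}\subset\widetilde S^6$ consists of the points of $\mathbb R^8$ having two coordinates equal to $-\frac{3}{2\sqrt6}$ and six equal to $\frac1{2\sqrt6}$, or two coordinates equal to $\frac{3}{2\sqrt6}$ and six equal to $-\frac1{2\sqrt6}$. The configuration $\overline\omega_{126}\subset\widetilde S^6$ consists of the points of $\mathbb R^8$ having one coordinate $\frac1{\sqrt2}$, one coordinate $-\frac1{\sqrt2}$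 and six zero coordinates, or four coordinates equal to $\frac1{2\sqrt2}$ and four equal to $-\frac1{2\sqrt2}$. *)

theory Defs
  imports "HOL-Analysis.Analysis"
begin

definition sphere6 :: "(real ^ 8) set" where
  "sphere6 = sphere 0 1 \<inter> {x. (\<Sum>i\<in>UNIV. x $ i) = 0}"

definition potential :: "(real \<Rightarrow> ereal) \<Rightarrow> (real ^ 8) set \<Rightarrow> real ^ 8 \<Rightarrow> ereal" where
  "potential f \<omega> x = (\<Sum>y\<in>\<omega>. f ((norm (x - y))\<^sup>2))"

definition omega56 :: "(real ^ 8) set" where
  "omega56 =
     {x. card {i. x $ i = - (3 / (2 * sqrt 6))} = 2 \<and> card {i. x $ i = 1 / (2 * sqrt 6)} = 6} \<union>
     {x. card {i. x $ i = 3 / (2 * sqrt 6)} = 2 \<and> card {i. x $ i = - (1 / (2 * sqrt 6))} = 6}"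

definition omega126 :: "(real ^ 8) set" where
  "omega126 =
     {x. card {i. x $ i = 1 / sqrt 2} = 1 \<and> card {i. x $ i = - (1 / sqrt 2)} = 1 \<and>
         card {i. x $ i = 0} = 6} \<union>
     {x. card {i. x $ i = 1 / (2 * sqrt 2)} = 4 \<and> card {i. x $ i = - (1 / (2 * sqrt 2))} = 4}"

definition strictly_convex_on :: "real set \<Rightarrow> (real \<Rightarrow> real) \<Rightarrow> bool" where
  "strictly_convex_on S g \<longleftrightarrow> convex S \<and>
     (\<forall>x\<in>S. \<forall>y\<in>S. \<forall>u>0. \<forall>v>0. x \<noteq> y \<longrightarrow> u + v = 1 \<longrightarrow>
        g (u * x + v * y) < u * g x + v * g y)"

text \<open>
  A function \<open>[0,4] \<rightarrow> (-\<infinity>,\<infinity>]\<close> is represented by a total function into the extended reals,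
  constrained only on \<open>[0,4]\<close>. Where \<open>f\<close> is finite, \<open>\<lambda>t. real_of_ereal (f t)\<close> is \<open>f\<close> itself as a
  real function; its iterated derivatives at points of the open interval \<open>(0,4)\<close> depend only
  on its values there.
\<close>

definition iter_deriv :: "(real \<Rightarrow> ereal) \<Rightarrow> nat \<Rightarrow> real \<Rightarrow> real" where
  "iter_deriv f k = (deriv ^^ k) (\<lambda>t. real_of_ereal (f t))"

text \<open>Since \<open>deriv\<close> is total, existence of the fourth derivative has to be required
  separately: each of the derivatives of order \<open>0,\<dots>,3\<close> is differentiable.\<close>

definition admissible :: "(real \<Rightarrow> ereal) \<Rightarrow> bool" where
  "admissible f \<longleftrightarrow>
     (\<forall>t\<in>{0..4}. f t \<noteq> -\<infinity>) \<and>
     (\<forall>t\<in>{0<..4}. f t \<noteq> \<infinity>) \<and>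
     continuous_on {0<..4} f \<and>
     (f \<longlongrightarrow> f 0) (at_right 0) \<and>
     (\<forall>k<4. \<forall>t\<in>{0<..<4}. iter_deriv f k differentiable (at t)) \<and>
     convex_on {0<..<4} (iter_deriv f 4)"

end

theory Submission
  imports Defs
begin

text \<open>
  Both configurations are antipodal and have constant second and fourth moments in the ratio \<open>3 : 1\<close>
  on the sphere, and every inner product between a point of one and a point of the other lies in
  \<open>{0, \<plusminus>1/\<surd>3}\<close>. By antipodality the potential is half the sum of \<open>f (2 - 2t) + f (2 + 2t)\<close> over the
  inner products \<open>t\<close>. This is an even function of \<open>t\<close> with convex fourth derivative, so (Rolle) it
  dominates the even quartic that interpolates it at \<open>0\<close> and to second order at \<open>\<plusminus>1/\<surd>3\<close>; the quartic
  has constant sum over the configuration. In the strict case equality forces all inner products to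
  lie in \<open>{0, \<plusminus>1/\<surd>3}\<close>, which pins down the coordinates.
\<close>

section \<open>Even Hermite interpolation\<close>

text \<open>Up to scale, \<open>omega126\<close> is the root system E_7 and \<open>omega56\<close>
  the set of minimal vectors of the dual lattice, in coordinates where S_8 acts by permutation;
  hence all the sums over subsets of the index set. The ratio 3 : 1 is that of the averages 1/7 and
  1/21 of t^2 and t^4 over the unit sphere of a 7-dimensional space. It makes t^2 (t^2 - 1/3) sum to
  zero over each configuration, which is what singles out 1/sqrt 3 as a node. Six interpolation
  conditions (0 counted twice by evenness) would normally call for the sign of a sixth derivative.
  Only a convex fourth derivative is given, so its convexity is tested directly on three points, two
  of which are mirror images. The delicate place is t = 1 or t = -1, where the arguments of
  \<open>f\<close> are 0 and 4: \<open>f\<close> may be infinite at 0 and no derivatives are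
  available at either end, so the interpolation error is studied for t strictly inside and the ends
  are reached by a limit.\<close>

lemma rolle_deriv:
  fixes g g' :: "real \<Rightarrow> real"
  assumes "a < b" "g a = g b"
    and "\<And>t. a \<le> t \<Longrightarrow> t \<le> b \<Longrightarrow> (g has_real_derivative g' t) (at t)"
  obtains z where "a < z" "z < b" "g' z = 0"
proof -
  have "\<exists>z. a < z \<and> z < b \<and> (*) (g' z) = (\<lambda>v. 0)"
  proof (rule Rolle_deriv[OF assms(1,2)])
    show "continuous_on {a..b} g"
      by (meson DERIV_isCont assms(3) atLeastAtMost_iff continuous_at_imp_continuous_on)
    show "(g has_derivative (*) (g' t)) (at t)" if "a < t" "t < b" for t
      using assms(3)[of t] that by (simp add: has_field_derivative_def)
  qed
  then obtain z where z: "a < z" "z < b" "(*) (g' z) = (\<lambda>v. 0)"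
    by blast
  from fun_cong[OF z(3), of 1] have "g' z = 0" by simp
  with z show ?thesis using that by blast
qed

text \<open>Halving by parity: only the zeros in \<open>(0,1)\<close> and the zero at \<open>0\<close> of the odd derivatives are
  counted, so two positive zeros of the fourth derivative stand for four.\<close>

lemma even_hermite_zeros:
  fixes p :: "nat \<Rightarrow> real \<Rightarrow> real"
  assumes der: "\<And>k t. k < 4 \<Longrightarrow> -1 < t \<Longrightarrow> t < 1 \<Longrightarrow> (p k has_real_derivative p (Suc k) t) (at t)"
    and s: "0 < s" "s < 1" and t: "0 < t" "t < 1" "t \<noteq> s"
    and z: "p 0 0 = 0" "p 0 s = 0" "p 0 t = 0" "p 1 s = 0" "p 1 0 = 0" "p 3 0 = 0"
  obtains q r where "0 < q" "q < r" "r < 1" "p 4 q = 0" "p 4 r = 0"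
proof -
  have rolle: "\<exists>z. a < z \<and> z < b \<and> p (Suc k) z = 0"
    if "k < 4" "-1 < a" "a < b" "b < 1" "p k a = 0" "p k b = 0" for k a b
  proof -
    have "(p k has_real_derivative p (Suc k) y) (at y)" if "a \<le> y" "y \<le> b" for y
      using der[of k y] that \<open>k < 4\<close> \<open>-1 < a\<close> \<open>b < 1\<close> by simp
    then obtain z where "a < z" "z < b" "p (Suc k) z = 0"
      using rolle_deriv[of a b "p k" "p (Suc k)"] \<open>a < b\<close> \<open>p k a = 0\<close> \<open>p k b = 0\<close> by metis
    then show ?thesis by blast
  qed
  \<comment> \<open>The double zero \<open>s\<close> is itself one of the three; Rolle supplies the
    other two, one in each gap between consecutive points of \<open>0\<close>, \<open>s\<close>,
    \<open>t\<close>.\<close>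
  obtain z1 z2 z3 where z123: "0 < z1" "z1 < z2" "z2 < z3" "z3 < 1" "p 1 z1 = 0" "p 1 z2 = 0" "p 1 z3 = 0"
  proof (cases "t < s")
    case True
    obtain z1 where z1: "0 < z1" "z1 < t" "p 1 z1 = 0"
      using rolle[of 0 0 t] t z by auto
    obtain z2 where "t < z2" "z2 < s" "p 1 z2 = 0"
      using rolle[of 0 t s] True s t z by auto
    with z1 show ?thesis using s z by (intro that[of z1 z2 s]) auto
  next
    case False
    obtain z1 where z1: "0 < z1" "z1 < s" "p 1 z1 = 0"
      using rolle[of 0 0 s] s z by auto
    obtain z2 where "s < z2" "z2 < t" "p 1 z2 = 0"
      using rolle[of 0 s t] False s t z by auto
    with z1 show ?thesis using t z by (intro that[of z1 s z2]) auto
  qed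
  obtain w1 w2 w3 where w: "0 < w1" "w1 < z1" "z1 < w2" "w2 < z2" "z2 < w3" "w3 < z3"
      "p 2 w1 = 0" "p 2 w2 = 0" "p 2 w3 = 0"
    using rolle[of 1 0 z1] rolle[of 1 z1 z2] rolle[of 1 z2 z3] z123 z that by (fastforce simp: numeral_2_eq_2)
  obtain y1 y2 where y: "w1 < y1" "y1 < w2" "w2 < y2" "y2 < w3" "p 3 y1 = 0" "p 3 y2 = 0"
    using rolle[of 2 w1 w2] rolle[of 2 w2 w3] w z123 that by (fastforce simp: numeral_eq_Suc)
  \<comment> \<open>Each Rolle step loses a zero, and the vanishing of the odd derivatives
    \<open>p 1\<close> and \<open>p 3\<close> at 0 gives one back each time. The counts on the
    positive side are 3, 3, 2, 2.\<close>
  obtain q r where "0 < q" "q < y1" "y1 < r" "r < y2" "p 4 q = 0" "p 4 r = 0"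
    using rolle[of 3 0 y1] rolle[of 3 y1 y2] w z123 y z that by (fastforce simp: numeral_eq_Suc)
  then show ?thesis using that[of q r] y w z123 by auto
qed

lemma zero_le_mult_pos2: "0 \<le> a * b \<Longrightarrow> 0 < b \<Longrightarrow> 0 \<le> a" for a b :: real
  by (simp add: zero_le_mult_iff)

lemma convex_on_combination:
  fixes g :: "real \<Rightarrow> real"
  shows "convex_on S g \<Longrightarrow> x \<in> S \<Longrightarrow> y \<in> S \<Longrightarrow> 0 \<le> u \<Longrightarrow> 0 \<le> v \<Longrightarrow> u + v = 1
    \<Longrightarrow> g (u * x + v * y) \<le> u * g x + v * g y"
  by (simp add: convex_on_def)

lemma strictly_convex_on_combination:
  "strictly_convex_on S g \<Longrightarrow> x \<in> S \<Longrightarrow> y \<in> S \<Longrightarrow> x \<noteq> y \<Longrightarrow> 0 < u \<Longrightarrow> 0 < v \<Longrightarrow> u + v = 1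
    \<Longrightarrow> g (u * x + v * y) < u * g x + v * g y"
  by (simp add: strictly_convex_on_def)

text \<open>Subtracting the multiple \<open>l\<close> of the even sextic d that makes the error
  vanish at \<open>t\<close> gives a function whose fourth derivative has zeros at q and r, and by
  parity at -q. There \<open>e 4\<close> equals \<open>l\<close> times a strictly convex function,
  so convexity of \<open>e 4\<close> at q, between -q and r, decides the sign of
  \<open>l\<close>.\<close>

lemma even_hermite_error:
  fixes e :: "nat \<Rightarrow> real \<Rightarrow> real"
  assumes der: "\<And>k t. k < 4 \<Longrightarrow> -1 < t \<Longrightarrow> t < 1 \<Longrightarrow> (e k has_real_derivative e (Suc k) t) (at t)"
    and s: "0 < s" "s < 1"
    and z: "e 0 0 = 0" "e 0 s = 0" "e 1 s = 0" "e 1 0 = 0" "e 3 0 = 0"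
    and even: "\<And>t. e 4 (- t) = e 4 t"
    and conv: "convex_on {-1<..<1} (e 4)"
    and t: "0 < t" "t < 1" "t \<noteq> s"
  shows "0 \<le> e 0 t" and "strictly_convex_on {-1<..<1} (e 4) \<Longrightarrow> 0 < e 0 t"
proof -
  \<comment> \<open>\<open>d k\<close> is the \<open>k\<close>-th derivative of \<open>x^2 (x^2 - s^2)^2\<close>; the sign of \<open>l\<close> is that of the error,
    and \<open>e - l d\<close> also vanishes at \<open>t\<close>.\<close>
  define l where "l = e 0 t / (t^2 * (t^2 - s^2)^2)"
  have nz: "t^2 * (t^2 - s^2)^2 > 0"
    using s t by (auto simp: power2_eq_iff)
  define d where "d k x = (if k = 0 then x^6 - 2 * s^2 * x^4 + s^4 * x^2
      else if k = 1 then 6 * x^5 - 8 * s^2 * x^3 + 2 * s^4 * x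
      else if k = 2 then 30 * x^4 - 24 * s^2 * x^2 + 2 * s^4
      else if k = 3 then 120 * x^3 - 48 * s^2 * x else 360 * x^2 - 48 * s^2)" for k :: nat and x :: real
  define p where "p k x = e k x - l * d k x" for k x
  have dd: "(d k has_real_derivative d (Suc k) x) (at x)" if "k < 4" for k x
  proof -
    from that consider "k = 0" | "k = 1" | "k = 2" | "k = 3" by linarith
    then show ?thesis
      by cases (auto simp: d_def[abs_def] intro!: derivative_eq_intros)
  qed
  have pd: "(p k has_real_derivative p (Suc k) x) (at x)" if "k < 4" "-1 < x" "x < 1" for k x
    unfolding p_def[abs_def] by (intro DERIV_diff DERIV_cmult dd der that)
  have "p 0 t = 0"
  proof -
    have "d 0 t = t^2 * (t^2 - s^2)^2" by (simp add: d_def) algebra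
    then have "l = e 0 t / d 0 t" "d 0 t \<noteq> 0" using nz by (simp_all only: l_def)
    then show ?thesis by (simp add: p_def)
  qed
  moreover have "d 0 s = 0" "d 1 s = 0" by (simp_all add: d_def, algebra+)
  ultimately obtain q r where qr: "0 < q" "q < r" "r < 1" "p 4 q = 0" "p 4 r = 0"
    using even_hermite_zeros[of p s t] pd s t z by (auto simp: p_def d_def)
  \<comment> \<open>The weights that express \<open>q\<close> as a convex combination of
    \<open>- q\<close> and \<open>r\<close>.\<close>
  define u where "u = (r - q) / (r + q)"
  define v where "v = 2 * q / (r + q)"
  have uv0: "0 < u" "0 < v" "v * (r + q) = 2 * q"
    using qr by (simp_all add: u_def v_def)
  have "u + v = 1"
    using qr unfolding u_def v_def add_divide_distrib[symmetric] by simp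
  then have "u = 1 - v" by simp
  have "u * (- q) + v * r = v * (r + q) - (u + v) * q"
    by (simp add: algebra_simps)
  then have "u * (- q) + v * r = q"
    using uv0 \<open>u + v = 1\<close> by simp
  with uv0 \<open>u + v = 1\<close> have uv: "0 < u" "0 < v" "u + v = 1" "u * (- q) + v * r = q"
    by blast+
  have el: "e 0 t = l * (t^2 * (t^2 - s^2)^2)"
    using nz unfolding l_def by (metis less_irrefl nonzero_eq_divide_eq)
  \<comment> \<open>\<open>d 4\<close> is quadratic with leading coefficient 360 and takes equal
    values at \<open>q\<close> and \<open>- q\<close>, so its convexity gap is
    \<open>360 * v * (r^2 - q^2)\<close>.\<close>
  have strict: "u * d 4 (- q) + v * d 4 r - d 4 q > 0"
  proof -
    have "q^2 < r^2" using qr by (simp add: power_strict_mono)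
    then have "0 < 360 * (v * (r^2 - q^2))" using uv by simp
    also have "\<dots> = u * d 4 (- q) + v * d 4 r - d 4 q"
      by (simp add: d_def \<open>u = 1 - v\<close> algebra_simps)
    finally show ?thesis .
  qed
  have e4: "e 4 (-q) = l * d 4 q" "e 4 q = l * d 4 q" "e 4 r = l * d 4 r" "d 4 (-q) = d 4 q"
    using qr even[of q] by (auto simp: p_def d_def)
  have gap: "u * e 4 (-q) + v * e 4 r - e 4 q = l * (u * d 4 (- q) + v * d 4 r - d 4 q)"
    by (simp add: e4 algebra_simps)
  have mem: "- q \<in> {-1<..<1}" "r \<in> {-1<..<1}" "- q \<noteq> r" "0 \<le> u" "0 \<le> v"
    using qr uv by auto
  have "e 4 (u * (- q) + v * r) \<le> u * e 4 (-q) + v * e 4 r"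
    by (rule convex_on_combination[OF conv]) (use mem uv in blast)+
  then have "0 \<le> l * (u * d 4 (- q) + v * d 4 r - d 4 q)"
    unfolding uv(4) gap[symmetric] by simp
  then have "l \<ge> 0"
    using strict by (rule zero_le_mult_pos2)
  then show "0 \<le> e 0 t" unfolding el using nz by (simp only: mult_nonneg_nonneg less_imp_le)
  show "0 < e 0 t" if sc: "strictly_convex_on {-1<..<1} (e 4)"
  proof -
    have "e 4 (u * (- q) + v * r) < u * e 4 (-q) + v * e 4 r"
      by (rule strictly_convex_on_combination[OF sc]) (use mem uv in blast)+
    then have "0 < l * (u * d 4 (- q) + v * d 4 r - d 4 q)"
      unfolding uv(4) gap[symmetric] by simp
    then have "l > 0"
      using strict by (rule zero_less_mult_pos2)
    then show ?thesis unfolding el using nz by (rule mult_pos_pos)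
  qed
qed

text \<open>The substitution comes from |x - y|^2 = 2 - 2 (x . y) on the unit sphere, with the
  antipode of y giving 2 + 2 (x . y). At the end points only the weak inequality survives, since it
  is obtained as a limit.\<close>

lemma admissible_even_minorant:
  fixes f :: "real \<Rightarrow> ereal"
  defines "h \<equiv> \<lambda>t. real_of_ereal (f t)" and "s \<equiv> 1 / sqrt 3"
  assumes adm: "admissible f"
  obtains a b c :: real where
    "\<And>t. \<bar>t\<bar> < 1 \<Longrightarrow> a + b * t^2 + c * t^4 \<le> h (2 - 2 * t) + h (2 + 2 * t)"
    "\<And>t. t \<in> {0, s, - s} \<Longrightarrow> a + b * t^2 + c * t^4 = h (2 - 2 * t) + h (2 + 2 * t)"
    "\<And>t. strictly_convex_on {0<..<4} (iter_deriv f 4) \<Longrightarrow> \<bar>t\<bar> < 1 \<Longrightarrow> t \<notin> {0, s, - s} \<Longrightarrow>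
       a + b * t^2 + c * t^4 < h (2 - 2 * t) + h (2 + 2 * t)"
    "f 0 \<noteq> \<infinity> \<Longrightarrow> a + b + c \<le> h 0 + h 4"
proof -
  have s: "0 < s" "s < 1" by (simp_all add: s_def)
  have s2: "s^2 = 1/3" by (simp add: s_def power_divide)
  have s3: "s^3 = s/3" using s2 by (simp add: power3_eq_cube power2_eq_square)
  have s4: "s^4 = 1/9" using arg_cong[OF s2, of "\<lambda>z. z^2"] by (simp add: power_divide flip: power_mult)
  define d where "d = iter_deriv f"
  have d0: "d 0 = h" by (simp add: d_def iter_deriv_def h_def)
  have dd: "(d k has_real_derivative d (Suc k) t) (at t)" if "k < 4" "0 < t" "t < 4" for k t
  proof -
    have "d k differentiable at t" using adm that by (simp add: admissible_def d_def)
    then show ?thesis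
      by (simp add: d_def iter_deriv_def DERIV_deriv_iff_real_differentiable)
  qed
  \<comment> \<open>\<open>G k\<close> is the k-th derivative of
    \<open>h (2 - 2 * t) + h (2 + 2 * t)\<close>; below, \<open>P k\<close> is that of the quartic
    and \<open>e k\<close> that of the error.\<close>
  define G where "G k t = (-2)^k * d k (2 - 2 * t) + 2^k * d k (2 + 2 * t)" for k t
  define a where "a = G 0 0"
  \<comment> \<open>Since s^2 = 1/3, the conditions at \<open>s\<close> read
    \<open>b + c / 3 = 3 * (G 0 s - a)\<close> and \<open>b + 2 * c / 3 = G 1 s / (2 * s)\<close>.
    Their difference gives \<open>c\<close>.\<close>
  define c where "c = 3 * (G 1 s / (2 * s) - 3 * (G 0 s - a))"
  define b where "b = 3 * (G 0 s - a) - c / 3"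
  define P where "P k t = (if k = 0 then a + b * t^2 + c * t^4 else if k = 1 then 2 * b * t + 4 * c * t^3
     else if k = 2 then 2 * b + 12 * c * t^2 else if k = 3 then 24 * c * t else 24 * c)" for k :: nat and t :: real
  define e where "e k t = G k t - P k t" for k t
  have Gd: "(G k has_real_derivative G (Suc k) t) (at t)" if "k < 4" "-1 < t" "t < 1" for k t
  proof -
    have "((\<lambda>t. d k (2 - 2 * t)) has_real_derivative d (Suc k) (2 - 2 * t) * (-2)) (at t)"
      by (rule DERIV_chain2[where f = "d k" and g = "\<lambda>t. 2 - 2 * t"])
         (use that in \<open>auto intro!: derivative_eq_intros dd\<close>)
    moreover have "((\<lambda>t. d k (2 + 2 * t)) has_real_derivative d (Suc k) (2 + 2 * t) * 2) (at t)"
      by (rule DERIV_chain2[where f = "d k" and g = "\<lambda>t. 2 + 2 * t"])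
         (use that in \<open>auto intro!: derivative_eq_intros dd\<close>)
    ultimately show ?thesis
      unfolding G_def[abs_def] by (auto intro!: derivative_eq_intros)
  qed
  have Pd: "(P k has_real_derivative P (Suc k) t) (at t)" if "k < 4" for k t
  proof -
    from that consider "k = 0" | "k = 1" | "k = 2" | "k = 3" by linarith
    then show ?thesis
      by cases (auto simp: P_def[abs_def] intro!: derivative_eq_intros)
  qed
  have ed: "(e k has_real_derivative e (Suc k) t) (at t)" if "k < 4" "-1 < t" "t < 1" for k t
    unfolding e_def[abs_def] by (intro DERIV_diff Gd Pd that)
  have z0: "e 0 0 = 0" "e 1 0 = 0" "e 3 0 = 0"
    by (simp_all add: e_def P_def a_def) (simp_all add: G_def)
  have "e 0 s = G 0 s - a - b / 3 - c / 9"
    by (simp add: e_def P_def s2 s4)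
  then have zs0: "e 0 s = 0" by (simp add: b_def diff_divide_distrib)
  have "e 1 s = G 1 s - 2 * s * (b + 2 * c / 3)"
    unfolding e_def P_def by (simp add: s3) algebra
  also have "b + 2 * c / 3 = 3 * (G 0 s - a) + c / 3" by (simp add: b_def)
  also have "\<dots> = G 1 s / (2 * s)" unfolding c_def by (simp add: diff_divide_distrib)
  finally have zs1: "e 1 s = 0" using s by simp
  \<comment> \<open>In even order both chain-rule factors are 16, so \<open>e 4\<close> is a sum of
    two convex functions and a constant.\<close>
  have e4: "e 4 t = 16 * (d 4 (2 - 2 * t) + d 4 (2 + 2 * t)) - 24 * c" for t
    by (simp add: e_def G_def P_def)
  have even: "e 4 (- t) = e 4 t" for t by (simp add: e4)
  have comb: "2 - 2 * (u * x + v * y) = u * (2 - 2 * x) + v * (2 - 2 * y)"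
    "2 + 2 * (u * x + v * y) = u * (2 + 2 * x) + v * (2 + 2 * y)"
    "z = u * z + v * z" if "u + v = 1" for u v x y z :: real
  proof -
    have u: "u = 1 - v" using that by simp
    show "2 - 2 * (u * x + v * y) = u * (2 - 2 * x) + v * (2 - 2 * y)"
      "2 + 2 * (u * x + v * y) = u * (2 + 2 * x) + v * (2 + 2 * y)" "z = u * z + v * z"
      by (simp_all add: u algebra_simps)
  qed
  have conv: "convex_on {-1<..<1} (e 4)"
    unfolding convex_on_def
  proof (intro conjI ballI allI impI)
    fix x y u v :: real
    assume xy: "x \<in> {-1<..<1}" "y \<in> {-1<..<1}" and uv: "0 \<le> u" "0 \<le> v" "u + v = 1"
    have cd: "d 4 (u * x' + v * y') \<le> u * d 4 x' + v * d 4 y'" if "x' \<in> {0<..<4}" "y' \<in> {0<..<4}" for x' y'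
      unfolding d_def by (rule convex_on_combination[OF _ that uv]) (use adm in \<open>simp add: admissible_def\<close>)
    have "e 4 (u * x + v * y) = 16 * (d 4 (u * (2 - 2 * x) + v * (2 - 2 * y)) +
        d 4 (u * (2 + 2 * x) + v * (2 + 2 * y))) - (u * (24 * c) + v * (24 * c))"
      unfolding e4 comb(1)[OF uv(3)] comb(2)[OF uv(3)] using comb(3)[OF uv(3), of "24 * c"] by simp
    also have "\<dots> \<le> 16 * ((u * d 4 (2 - 2 * x) + v * d 4 (2 - 2 * y)) + (u * d 4 (2 + 2 * x) + v * d 4 (2 + 2 * y)))
        - (u * (24 * c) + v * (24 * c))"
      using cd[of "2 - 2 * x" "2 - 2 * y"] cd[of "2 + 2 * x" "2 + 2 * y"] xy by auto
    also have "\<dots> = u * e 4 x + v * e 4 y" by (simp add: e4 algebra_simps)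
    finally show "e 4 (u *\<^sub>R x + v *\<^sub>R y) \<le> u * e 4 x + v * e 4 y" by simp
  qed simp
  have sconv: "strictly_convex_on {-1<..<1} (e 4)" if sc: "strictly_convex_on {0<..<4} (iter_deriv f 4)"
    unfolding strictly_convex_on_def
  proof (intro conjI ballI allI impI)
    fix x y u v :: real
    assume xy: "x \<in> {-1<..<1}" "y \<in> {-1<..<1}" "x \<noteq> y" and uv: "0 < u" "0 < v" "u + v = 1"
    have cd: "d 4 (u * x' + v * y') < u * d 4 x' + v * d 4 y'"
      if "x' \<in> {0<..<4}" "y' \<in> {0<..<4}" "x' \<noteq> y'" for x' y'
      unfolding d_def by (intro strictly_convex_on_combination[OF sc] uv that)
    have "e 4 (u * x + v * y) = 16 * (d 4 (u * (2 - 2 * x) + v * (2 - 2 * y)) +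
        d 4 (u * (2 + 2 * x) + v * (2 + 2 * y))) - (u * (24 * c) + v * (24 * c))"
      unfolding e4 comb(1)[OF uv(3)] comb(2)[OF uv(3)] using comb(3)[OF uv(3), of "24 * c"] by simp
    also have "\<dots> < 16 * ((u * d 4 (2 - 2 * x) + v * d 4 (2 - 2 * y)) + (u * d 4 (2 + 2 * x) + v * d 4 (2 + 2 * y)))
        - (u * (24 * c) + v * (24 * c))"
      using cd[of "2 - 2 * x" "2 - 2 * y"] cd[of "2 + 2 * x" "2 + 2 * y"] xy by auto
    also have "\<dots> = u * e 4 x + v * e 4 y" by (simp add: e4 algebra_simps)
    finally show "e 4 (u * x + v * y) < u * e 4 x + v * e 4 y" .
  qed simp
  have e0: "e 0 t = h (2 - 2 * t) + h (2 + 2 * t) - (a + b * t^2 + c * t^4)" for t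
    by (simp add: e_def G_def P_def d0)
  have sym: "e 0 \<bar>t\<bar> = e 0 t" for t
    by (simp add: e0 abs_if)
  note err = even_hermite_error[of e s, OF ed s z0(1) zs0 zs1 z0(2,3) even conv]
  have nonneg: "0 \<le> e 0 t" if "\<bar>t\<bar> < 1" for t
  proof (cases "\<bar>t\<bar> = 0 \<or> \<bar>t\<bar> = s")
    case True
    then show ?thesis using z0 zs0 sym[of t] by auto
  next
    case False
    then show ?thesis using err(1)[of "\<bar>t\<bar>"] that by (auto simp: sym)
  qed
  show ?thesis
  proof (rule that[of a b c])
    show "a + b * t^2 + c * t^4 \<le> h (2 - 2 * t) + h (2 + 2 * t)" if "\<bar>t\<bar> < 1" for t
      using nonneg[OF that] by (simp add: e0)
    show "a + b * t^2 + c * t^4 = h (2 - 2 * t) + h (2 + 2 * t)" if "t \<in> {0, s, - s}" for t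
    proof -
      have "e 0 t = 0" using that z0 zs0 sym[of "- s"] s by auto
      then show ?thesis by (simp add: e0)
    qed
    show "a + b * t^2 + c * t^4 < h (2 - 2 * t) + h (2 + 2 * t)"
      if "strictly_convex_on {0<..<4} (iter_deriv f 4)" "\<bar>t\<bar> < 1" "t \<notin> {0, s, - s}" for t
    proof -
      have "0 < e 0 \<bar>t\<bar>"
        by (rule err(2)) (use that sconv in \<open>auto simp: abs_if split: if_splits\<close>)
      then show ?thesis unfolding sym by (simp add: e0)
    qed
    show "a + b + c \<le> h 0 + h 4" if fin: "f 0 \<noteq> \<infinity>"
    proof -
      have "f 0 = ereal (h 0)" "f 4 = ereal (h 4)"
        using adm fin unfolding h_def admissible_def by (auto simp: ereal_real)
      moreover have "(f \<longlongrightarrow> f 0) (at_right 0)" using adm by (simp add: admissible_def)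
      \<comment> \<open>Continuity on \<open>{0<..4}\<close> gives a one-sided limit at 4; the
        restriction to \<open>{1..4}\<close> is a closed interval on which that limit is
        \<open>at_left 4\<close>.\<close>
      moreover have "(f \<longlongrightarrow> f 4) (at_left 4)"
      proof -
        have "(f \<longlongrightarrow> f 4) (at 4 within {0<..4})"
          using adm unfolding admissible_def continuous_on_def by auto
        then have "(f \<longlongrightarrow> f 4) (at 4 within {1..4})"
          by (rule tendsto_within_subset) auto
        then show ?thesis by (simp add: at_within_Icc_at_left)
      qed
      ultimately have lim: "(h \<longlongrightarrow> h 0) (at_right 0)" "(h \<longlongrightarrow> h 4) (at_left 4)"
        unfolding h_def by (auto intro!: lim_real_of_ereal)
      \<comment> \<open>As t tends to 1 from below, the two arguments tend to 0 from above and to 4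
        from below, so the inequality on the open interval passes to the limit.\<close>
      have "filterlim (\<lambda>t::real. 2 - 2 * t) (at_right 0) (at_left 1)"
        unfolding filterlim_at by (auto intro!: tendsto_eq_intros simp: eventually_at_left_field intro: lt_ex)
      moreover have "filterlim (\<lambda>t::real. 2 + 2 * t) (at_left 4) (at_left 1)"
        unfolding filterlim_at by (auto intro!: tendsto_eq_intros simp: eventually_at_left_field intro: lt_ex)
      ultimately have "((\<lambda>t. h (2 - 2 * t) + h (2 + 2 * t)) \<longlongrightarrow> h 0 + h 4) (at_left 1)"
        by (intro tendsto_add filterlim_compose[OF lim(1)] filterlim_compose[OF lim(2)])
      moreover have "((\<lambda>t. a + b * t^2 + c * t^4) \<longlongrightarrow> a + b + c) (at_left 1)"
        by (auto intro!: tendsto_eq_intros)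
      moreover have "\<forall>\<^sub>F t in at_left 1. a + b * t^2 + c * t^4 \<le> h (2 - 2 * t) + h (2 + 2 * t)"
        unfolding eventually_at_left_field
      proof (intro exI[of _ 0] conjI allI impI)
        fix t :: real assume "0 < t" "t < 1"
        then show "a + b * t^2 + c * t^4 \<le> h (2 - 2 * t) + h (2 + 2 * t)"
          using nonneg[of t] by (simp add: e0)
      qed simp
      ultimately show ?thesis
        by (intro tendsto_le) auto
    qed
  qed
qed

section \<open>Potentials of antipodal designs\<close>

abbreviation "dots \<equiv> {0, 1 / sqrt 3, - (1 / sqrt 3)} :: real set"

lemma norm_diff_sphere6:
  assumes "x \<in> sphere6" "y \<in> sphere6"
  shows "(norm (x - y))^2 = 2 - 2 * (x \<bullet> y)"
proof -
  have "x \<bullet> x = 1" "y \<bullet> y = 1" using assms by (auto simp: sphere6_def dot_square_norm)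
  then show ?thesis by (simp add: power2_norm_eq_inner inner_diff_left inner_diff_right inner_commute)
qed

lemma inner_sphere6_bound:
  assumes "x \<in> sphere6" "y \<in> sphere6"
  shows "\<bar>x \<bullet> y\<bar> \<le> 1"
  using Cauchy_Schwarz_ineq2[of x y] assms by (simp add: sphere6_def)

text \<open>A linear programming bound: the quartic minorant has the same sum for every
  \<open>x\<close>, so \<open>C\<close> is a lower bound, and it is reached when all inner products
  are nodes.\<close>

lemma potential_on_design:
  fixes f :: "real \<Rightarrow> ereal" and \<omega> :: "(real ^ 8) set"
  assumes adm: "admissible f" and fin: "finite \<omega>" and sub: "\<omega> \<subseteq> sphere6"
    and anti: "uminus ` \<omega> = \<omega>"
    and mom: "\<And>x. x \<in> sphere6 \<Longrightarrow> (\<Sum>y\<in>\<omega>. (x \<bullet> y)^2) = 3 * K"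
      "\<And>x. x \<in> sphere6 \<Longrightarrow> (\<Sum>y\<in>\<omega>. (x \<bullet> y)^4) = K"
  obtains C :: real where
    "\<forall>x\<in>sphere6. ereal C \<le> potential f \<omega> x"
    "\<forall>x\<in>sphere6. (\<forall>y\<in>\<omega>. x \<bullet> y \<in> dots) \<longrightarrow> potential f \<omega> x = ereal C"
    "strictly_convex_on {0<..<4} (iter_deriv f 4) \<longrightarrow>
       (\<forall>x\<in>sphere6. potential f \<omega> x = ereal C \<longrightarrow> (\<forall>y\<in>\<omega>. x \<bullet> y \<in> dots))"
proof -
  define h where "h t = real_of_ereal (f t)" for t
  define D where "D = dots"
  obtain a b c where minor:
    "\<And>t. \<bar>t\<bar> < 1 \<Longrightarrow> a + b * t^2 + c * t^4 \<le> h (2 - 2 * t) + h (2 + 2 * t)"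
    "\<And>t. t \<in> D \<Longrightarrow> a + b * t^2 + c * t^4 = h (2 - 2 * t) + h (2 + 2 * t)"
    "\<And>t. strictly_convex_on {0<..<4} (iter_deriv f 4) \<Longrightarrow> \<bar>t\<bar> < 1 \<Longrightarrow> t \<notin> D \<Longrightarrow>
       a + b * t^2 + c * t^4 < h (2 - 2 * t) + h (2 + 2 * t)"
    "f 0 \<noteq> \<infinity> \<Longrightarrow> a + b + c \<le> h 0 + h 4"
    using admissible_even_minorant[OF adm, folded h_def D_def] by metis
  \<comment> \<open>Half the sum of the quartic over the design, read off from the two
    moments.\<close>
  define C where "C = (card \<omega> * a + 3 * K * b + K * c) / 2"
  define M where "M t = a + b * t^2 + c * t^4" for t :: real
  define E where "E t = h (2 - 2 * t) + h (2 + 2 * t)" for t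
  have M: "(\<Sum>y\<in>\<omega>. M (x \<bullet> y)) = 2 * C" if "x \<in> sphere6" for x
    using mom[OF that] by (simp add: M_def C_def sum.distrib flip: sum_distrib_left)
  \<comment> \<open>\<open>real_of_ereal\<close> sends infinity to 0, so \<open>h\<close>
    misrepresents \<open>f\<close> at 0 when \<open>f 0\<close> is infinite. This matters only if
    some distance vanishes, that is, for \<open>x\<close> in the design.\<close>
  have pot: "potential f \<omega> x = ereal ((\<Sum>y\<in>\<omega>. E (x \<bullet> y)) / 2)"
    if x: "x \<in> sphere6" and finite: "f 0 \<noteq> \<infinity> \<or> x \<notin> \<omega>" for x
  proof -
    have "f (2 - 2 * (x \<bullet> y)) = ereal (h (2 - 2 * (x \<bullet> y)))" if "y \<in> \<omega>" for y
    proof -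
      have n: "2 - 2 * (x \<bullet> y) = (norm (x - y))^2" using norm_diff_sphere6 x sub that by auto
      have "2 - 2 * (x \<bullet> y) \<in> {0..4}"
        using inner_sphere6_bound[OF x, of y] sub that by (auto simp: abs_le_iff)
      moreover have "2 - 2 * (x \<bullet> y) = 0 \<Longrightarrow> x = y" unfolding n by simp
      ultimately show ?thesis
        using adm finite that unfolding h_def admissible_def
        by (cases "2 - 2 * (x \<bullet> y) = 0") (auto simp: ereal_real)
    qed
    then have "potential f \<omega> x = (\<Sum>y\<in>\<omega>. ereal (h (2 - 2 * (x \<bullet> y))))"
      unfolding potential_def using norm_diff_sphere6[OF x] sub by (intro sum.cong refl) auto
    moreover have "(\<Sum>y\<in>\<omega>. h (2 - 2 * (x \<bullet> y))) = (\<Sum>y\<in>\<omega>. h (2 + 2 * (x \<bullet> y)))"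
      using sum.reindex[of uminus \<omega> "\<lambda>y. h (2 - 2 * (x \<bullet> y))"] by (simp add: anti)
    ultimately show ?thesis by (simp add: E_def sum.distrib)
  qed
  have ME: "M (x \<bullet> y) \<le> E (x \<bullet> y)"
    if x: "x \<in> sphere6" and y: "y \<in> \<omega>" and finite: "f 0 \<noteq> \<infinity> \<or> x \<notin> \<omega>" for x y
  proof (cases "\<bar>x \<bullet> y\<bar> < 1")
    case True
    then show ?thesis using minor(1) by (simp add: M_def E_def)
  next
    case False
    \<comment> \<open>An inner product of modulus 1 means that \<open>x\<close> is \<open>y\<close>
      or \<open>- y\<close>, which lies in the design by antipodality; then \<open>finite\<close>
      forces \<open>f 0\<close> to be finite and the limiting inequality applies.\<close>
    then consider "x \<bullet> y = 1" | "x \<bullet> (- y) = 1"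
      using inner_sphere6_bound[OF x, of y] sub y by (auto simp: abs_if split: if_splits)
    then have "f 0 \<noteq> \<infinity>"
    proof cases
      case 1
      then have "x = y" using norm_diff_sphere6[OF x, of y] sub y by auto
      then show ?thesis using finite y by simp
    next
      case 2
      have "- y \<in> \<omega>" using y anti by blast
      then have "(norm (x - (- y)))^2 = 0"
        using norm_diff_sphere6[OF x, of "- y"] sub 2 by (auto simp del: inner_minus_right)
      then have "x = - y" by (simp add: eq_neg_iff_add_eq_0)
      then show ?thesis using finite \<open>- y \<in> \<omega>\<close> by simp
    qed
    moreover have "x \<bullet> y = 1 \<or> x \<bullet> y = -1"
      using False inner_sphere6_bound[OF x, of y] sub y by (auto simp: abs_if split: if_splits)
    ultimately show ?thesis using minor(4) by (auto simp: M_def E_def)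
  qed
  have infinite_case: "potential f \<omega> x = \<infinity>" if "f 0 = \<infinity>" "x \<in> \<omega>" for x
    unfolding potential_def using fin that by (auto simp: sum_Pinfty intro!: bexI[of _ x])
  show ?thesis
  proof (rule that[of C]; intro ballI impI)
    fix x assume x: "x \<in> sphere6"
    show "ereal C \<le> potential f \<omega> x"
    proof (cases "f 0 \<noteq> \<infinity> \<or> x \<notin> \<omega>")
      case True
      then have "2 * C \<le> (\<Sum>y\<in>\<omega>. E (x \<bullet> y))"
        unfolding M[OF x, symmetric] by (intro sum_mono ME x)
      then show ?thesis unfolding pot[OF x True] by simp
    qed (use infinite_case in auto)
    show "potential f \<omega> x = ereal C" if D: "\<forall>y\<in>\<omega>. x \<bullet> y \<in> dots"
    proof -
      \<comment> \<open>A point of the design would have inner product 1 with itself, which is not a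
        node. So the formula \<open>pot\<close> is available even when \<open>f 0\<close> is
        infinite.\<close>
      have "x \<notin> \<omega>"
      proof
        assume "x \<in> \<omega>"
        moreover have "x \<bullet> x = 1" using x by (simp add: sphere6_def dot_square_norm)
        moreover have "(x \<bullet> x)^2 \<noteq> 1" using bspec[OF D \<open>x \<in> \<omega>\<close>] by (auto simp: power_divide)
        ultimately show False by simp
      qed
      moreover have "(\<Sum>y\<in>\<omega>. E (x \<bullet> y)) = (\<Sum>y\<in>\<omega>. M (x \<bullet> y))"
        using minor(2) D unfolding M_def E_def D_def by (intro sum.cong refl) metis
      ultimately show ?thesis by (simp add: pot x M)
    qed
    fix y
    assume sc: "strictly_convex_on {0<..<4} (iter_deriv f 4)" and eq: "potential f \<omega> x = ereal C" and y: "y \<in> \<omega>"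
    have finite: "f 0 \<noteq> \<infinity> \<or> x \<notin> \<omega>" using eq infinite_case by auto
    have "(\<Sum>y\<in>\<omega>. E (x \<bullet> y) - M (x \<bullet> y)) = 0"
      using eq by (simp add: sum_subtractf pot[OF x finite] M[OF x])
    then have EM: "E (x \<bullet> y) = M (x \<bullet> y)" if "y \<in> \<omega>" for y
      using ME[OF x _ finite] that by (subst (asm) sum_nonneg_eq_0_iff[OF fin]) auto
    have trichotomy: "x \<bullet> y \<in> D \<or> (x \<bullet> y)^2 = 1" if "y \<in> \<omega>" for y
    proof (cases "\<bar>x \<bullet> y\<bar> < 1")
      case True
      then show ?thesis using minor(3)[OF sc, of "x \<bullet> y"] EM[OF that] by (auto simp: M_def E_def)
    next
      case False
      then have "x \<bullet> y = 1 \<or> x \<bullet> y = -1"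
        using inner_sphere6_bound[OF x, of y] sub that by (auto simp: abs_if split: if_splits)
      then show ?thesis by auto
    qed
    \<comment> \<open>\<open>t^2 (t^2 - 1/3)\<close> has vanishing sum over the design and is positive at \<open>t = \<plusminus>1\<close>, so the end
      points, where nothing strict is known about \<open>f\<close>, cannot occur.\<close>
    have D_root: "t^2 * (t^2 - 1/3) = 0" if "t \<in> D" for t
      using that by (auto simp: D_def power_divide)
    have "(x \<bullet> y)^2 * ((x \<bullet> y)^2 - 1/3) = (x \<bullet> y)^4 - (x \<bullet> y)^2 / 3" for y
      by (simp add: algebra_simps flip: power_add)
    then have "(\<Sum>y\<in>\<omega>. (x \<bullet> y)^2 * ((x \<bullet> y)^2 - 1/3)) = 0"
      using mom[OF x] by (simp add: sum_subtractf flip: sum_divide_distrib)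
    moreover have "0 \<le> (x \<bullet> y)^2 * ((x \<bullet> y)^2 - 1/3)" if "y \<in> \<omega>" for y
      using trichotomy[OF that] D_root[of "x \<bullet> y"] by auto
    ultimately have "(x \<bullet> y)^2 * ((x \<bullet> y)^2 - 1/3) = 0"
      using y by (subst (asm) sum_nonneg_eq_0_iff[OF fin]) auto
    then have "(x \<bullet> y)^2 \<noteq> 1" by auto
    with trichotomy[OF y] show "x \<bullet> y \<in> dots"
      by (simp add: D_def)
  qed
qed

section \<open>Power sums over subsets\<close>

lemma card_supersets:
  fixes T :: "'a::finite set"
  assumes "card T \<le> k"
  shows "card {A. card A = k \<and> T \<subseteq> A} = (CARD('a) - card T) choose (k - card T)"
proof -
  have "bij_betw (\<lambda>B. B \<union> T) {B. B \<subseteq> - T \<and> card B = k - card T} {A. card A = k \<and> T \<subseteq> A}"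
  proof (rule bij_betwI[where g = "\<lambda>A. A - T"])
    show "(\<lambda>B. B \<union> T) \<in> {B. B \<subseteq> - T \<and> card B = k - card T} \<rightarrow> {A. card A = k \<and> T \<subseteq> A}"
    proof clarsimp
      fix B assume B: "B \<subseteq> - T" "card B = k - card T"
      have "card (B \<union> T) = card B + card T"
        using B by (intro card_Un_disjoint) auto
      then show "card (B \<union> T) = k" using B assms by simp
    qed
  qed (auto simp: card_Diff_subset)
  then have "card {A. card A = k \<and> T \<subseteq> A} = card {B. B \<subseteq> - T \<and> card B = k - card T}"
    by (simp add: bij_betw_same_card)
  also have "\<dots> = card (- T) choose (k - card T)"
    by (rule n_subsets) simp
  finally show ?thesis by (simp add: card_Diff_subset Compl_eq_Diff_UNIV)
qed

text \<open>The number of k-subsets of an 8-element set that contain d given elements. The guard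
  matters: for d > k truncated subtraction would give a binomial coefficient 1 instead of 0.\<close>

definition num_supersets :: "nat \<Rightarrow> nat \<Rightarrow> real" where
  "num_supersets k d = (if d \<le> k then real ((8 - d) choose (k - d)) else 0)"

lemma sum_num_supersets:
  fixes T :: "8 set"
  shows "(\<Sum>A | card A = k. of_bool (T \<subseteq> A)) = num_supersets k (card T)"
proof -
  have "(\<Sum>A | card A = k. of_bool (T \<subseteq> A)) = real (card {A. card A = k \<and> T \<subseteq> A})"
    by (simp add: of_bool_def sum.If_cases Int_def)
  also have "\<dots> = num_supersets k (card T)"
  proof (cases "card T \<le> k")
    case False
    then have "{A. card A = k \<and> T \<subseteq> A} = {}"
      using card_mono[OF finite] by auto
    with False show ?thesis unfolding num_supersets_def by (simp only: card.empty) simp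
  qed (simp add: card_supersets num_supersets_def)
  finally show ?thesis .
qed

lemma sum_as_indicator:
  fixes x :: "real ^ 8"
  shows "(\<Sum>i\<in>A. x $ i) = (\<Sum>i\<in>UNIV. x $ i * of_bool (i \<in> A))"
  by (simp add: of_bool_def if_distrib sum.If_cases)

text \<open>After expanding the power and exchanging sums, an index tuple is counted once for every
  k-set containing all its entries, and this count depends only on how many entries are
  distinct.\<close>

lemma subset_sum_square:
  fixes x :: "real ^ 8"
  shows "(\<Sum>A | card A = k. (\<Sum>i\<in>A. x $ i)^2)
    = (\<Sum>i\<in>UNIV. \<Sum>j\<in>UNIV. x $ i * x $ j * num_supersets k (card {i, j}))"
proof -
  have "(\<Sum>A | card A = k. (\<Sum>i\<in>A. x $ i)^2)
    = (\<Sum>A | card A = k. \<Sum>i\<in>UNIV. \<Sum>j\<in>UNIV. x $ i * x $ j * of_bool ({i, j} \<subseteq> A))"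
    unfolding sum_as_indicator[of x "A" for A] power2_eq_square sum_product
    by (intro sum.cong refl) auto
  also have "\<dots> = (\<Sum>i\<in>UNIV. \<Sum>j\<in>UNIV. \<Sum>A | card A = k. x $ i * x $ j * of_bool ({i, j} \<subseteq> A))"
    by (subst sum.swap, subst (2) sum.swap) (rule refl)
  finally show ?thesis
    by (simp only: sum_num_supersets flip: sum_distrib_left)
qed

lemma subset_sum_fourth:
  fixes x :: "real ^ 8"
  shows "(\<Sum>A | card A = k. (\<Sum>i\<in>A. x $ i)^4)
    = (\<Sum>i\<in>UNIV. \<Sum>j\<in>UNIV. \<Sum>m\<in>UNIV. \<Sum>n\<in>UNIV.
         x $ i * x $ j * x $ m * x $ n * num_supersets k (card {i, j, m, n}))"
proof -
  have "(\<Sum>i\<in>A. x $ i)^4 = (\<Sum>i\<in>UNIV. \<Sum>j\<in>UNIV. \<Sum>m\<in>UNIV. \<Sum>n\<in>UNIV.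
         x $ i * x $ j * x $ m * x $ n * of_bool ({i, j, m, n} \<subseteq> A))" for A
  proof -
    have "(\<Sum>i\<in>A. x $ i)^4 = (\<Sum>i\<in>A. x $ i) * ((\<Sum>i\<in>A. x $ i) * ((\<Sum>i\<in>A. x $ i) * (\<Sum>i\<in>A. x $ i)))"
      by (simp add: power4_eq_xxxx)
    also have "\<dots> = (\<Sum>i\<in>UNIV. \<Sum>j\<in>UNIV. \<Sum>m\<in>UNIV. \<Sum>n\<in>UNIV.
        (x $ i * of_bool (i \<in> A)) * ((x $ j * of_bool (j \<in> A)) * ((x $ m * of_bool (m \<in> A)) * (x $ n * of_bool (n \<in> A)))))"
      unfolding sum_as_indicator[of x A] sum_distrib_right unfolding sum_distrib_left by (rule refl)
    also have "\<dots> = (\<Sum>i\<in>UNIV. \<Sum>j\<in>UNIV. \<Sum>m\<in>UNIV. \<Sum>n\<in>UNIV.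
         x $ i * x $ j * x $ m * x $ n * of_bool ({i, j, m, n} \<subseteq> A))"
      by (intro sum.cong refl) auto
    finally show ?thesis .
  qed
  then have "(\<Sum>A | card A = k. (\<Sum>i\<in>A. x $ i)^4)
    = (\<Sum>A | card A = k. \<Sum>i\<in>UNIV. \<Sum>j\<in>UNIV. \<Sum>m\<in>UNIV. \<Sum>n\<in>UNIV.
         x $ i * x $ j * x $ m * x $ n * of_bool ({i, j, m, n} \<subseteq> A))"
    by simp
  also have "\<dots> = (\<Sum>i\<in>UNIV. \<Sum>j\<in>UNIV. \<Sum>m\<in>UNIV. \<Sum>n\<in>UNIV. \<Sum>A | card A = k.
         x $ i * x $ j * x $ m * x $ n * of_bool ({i, j, m, n} \<subseteq> A))"
    by (subst sum.swap, subst (2) sum.swap, subst (3) sum.swap, subst (4) sum.swap) (rule refl)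
  finally show ?thesis
    by (simp only: sum_num_supersets flip: sum_distrib_left)
qed

text \<open>Write \<open>N (card {i, j, m, n})\<close> as a combination of indicators of coincidences among the
  indices; every pattern that leaves some index isolated contributes a factor \<open>\<Sum>i. x $ i = 0\<close>.\<close>

lemma pattern_sum_square:
  fixes x :: "real ^ 'n" and N :: "nat \<Rightarrow> real"
  assumes "(\<Sum>i\<in>UNIV. x $ i) = 0"
  shows "(\<Sum>i\<in>UNIV. \<Sum>j\<in>UNIV. x $ i * x $ j * N (card {i, j}))
    = (N 1 - N 2) * (\<Sum>i\<in>UNIV. (x $ i)^2)"
proof -
  have "x $ i * x $ j * N (card {i, j}) = N 2 * x $ i * x $ j + (N 1 - N 2) * (if i = j then x $ i * x $ j else 0)" for i j
    by (cases "i = j") (simp_all add: algebra_simps card_insert_if flip: numeral_2_eq_2)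
  then show ?thesis
    using assms by (simp add: sum.distrib power2_eq_square flip: sum_distrib_left)
qed

lemma pattern_sum_fourth:
  fixes x :: "real ^ 'n" and N :: "nat \<Rightarrow> real"
  assumes "(\<Sum>i\<in>UNIV. x $ i) = 0"
  shows "(\<Sum>i\<in>UNIV. \<Sum>j\<in>UNIV. \<Sum>m\<in>UNIV. \<Sum>n\<in>UNIV. x $ i * x $ j * x $ m * x $ n * N (card {i, j, m, n}))
    = 3 * (N 2 - 2 * N 3 + N 4) * (\<Sum>i\<in>UNIV. (x $ i)^2)^2
      + (N 1 - 7 * N 2 + 12 * N 3 - 6 * N 4) * (\<Sum>i\<in>UNIV. (x $ i)^4)"
proof -
  \<comment> \<open>Inversion over the coincidence patterns of four indices: \<open>a\<close> weighs
    one equal pair, \<open>b\<close> two pairs, \<open>c\<close> a triple, \<open>d\<close> all four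
    equal. Each coefficient is what remains after the coarser contributions of its sub-coincidences
    are subtracted.\<close>
  define a where "a = N 3 - N 4"
  define b where "b = N 2 - N 4 - 2 * a"
  define c where "c = N 2 - N 4 - 3 * a"
  define d where "d = N 1 - N 4 - 6 * a - 3 * b - 4 * c"
  have N: "N 3 = N 4 + a" "N 2 = N 4 + 2 * a + b" "c = b - a" "N 1 = N 4 + 6 * a + 3 * b + 4 * (b - a) + d"
    by (simp_all add: a_def b_def c_def d_def)
  note N' = N[unfolded numeral_eq_Suc pred_numeral_simps One_nat_def, simplified]
  have pat: "N (card {i, j, m, n}) = N 4
     + a * (of_bool (i = j) + of_bool (i = m) + of_bool (i = n) + of_bool (j = m) + of_bool (j = n) + of_bool (m = n))
     + b * (of_bool (i = j \<and> m = n) + of_bool (i = m \<and> j = n) + of_bool (i = n \<and> j = m))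
     + c * (of_bool (i = j \<and> j = m) + of_bool (i = j \<and> j = n) + of_bool (i = m \<and> m = n) + of_bool (j = m \<and> m = n))
     + d * of_bool (i = j \<and> j = m \<and> m = n)" for i j m n :: 'n
    by (cases "i = j"; cases "i = m"; cases "i = n"; cases "j = m"; cases "j = n"; cases "m = n";
        simp add: N' card_insert_if eval_nat_numeral)
  have D: "(\<Sum>j\<in>UNIV. f j * of_bool (i = j)) = f i" for f :: "'n \<Rightarrow> real" and i
    by (simp add: of_bool_def if_distrib cong: if_cong)
  define p2 where "p2 = (\<Sum>i\<in>UNIV. (x $ i)^2)"
  define p3 where "p3 = (\<Sum>i\<in>UNIV. (x $ i)^3)"
  define p4 where "p4 = (\<Sum>i\<in>UNIV. (x $ i)^4)"
  have p1: "(\<Sum>i\<in>UNIV. K * x $ i) = 0" "(\<Sum>i\<in>UNIV. K * (x $ i)^2) = K * p2"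
    "(\<Sum>i\<in>UNIV. K * (x $ i)^3) = K * p3" "(\<Sum>i\<in>UNIV. K * (x $ i)^4) = K * p4" for K
    by (simp_all add: assms p2_def p3_def p4_def flip: sum_distrib_left)
  \<comment> \<open>The sums are evaluated from the innermost index outwards: terms without a
    coincidence at the current index vanish with the sum of \<open>x\<close>, the others replace
    that index by an earlier one or raise a power.\<close>
  have s1: "(\<Sum>n\<in>UNIV. x $ n * N (card {i, j, m, n}))
    = x $ i * (a + b * of_bool (j = m)) + x $ j * (a + b * of_bool (i = m) + c * of_bool (i = j))
      + x $ m * (a + b * of_bool (i = j) + c * of_bool (i = m) + c * of_bool (j = m)
        + d * of_bool (i = j) * of_bool (j = m))" for i j m
  proof -
    have "x $ n * N (card {i, j, m, n})
     = (N 4 + a * (of_bool (i = j) + of_bool (i = m) + of_bool (j = m)) + c * of_bool (i = j) * of_bool (j = m)) * x $ n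
      + (x $ n * (a + b * of_bool (j = m))) * of_bool (i = n)
      + (x $ n * (a + b * of_bool (i = m) + c * of_bool (i = j))) * of_bool (j = n)
      + (x $ n * (a + b * of_bool (i = j) + c * of_bool (i = m) + c * of_bool (j = m)
        + d * of_bool (i = j) * of_bool (j = m))) * of_bool (m = n)" for n
      unfolding pat of_bool_conj by (simp only: algebra_simps)
    then show ?thesis by (simp only: sum.distrib D p1)
  qed
  have s2: "(\<Sum>m\<in>UNIV. x $ m * (\<Sum>n\<in>UNIV. x $ n * N (card {i, j, m, n})))
    = 2 * b * x $ i * x $ j + c * (x $ i)^2 + (c + d * of_bool (i = j)) * (x $ j)^2
      + (a + b * of_bool (i = j)) * p2" for i j
  proof -
    have "x $ m * (\<Sum>n\<in>UNIV. x $ n * N (card {i, j, m, n}))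
      = (a * x $ i + a * x $ j + c * of_bool (i = j) * x $ j) * x $ m
       + (x $ m * (b * x $ j + c * x $ m)) * of_bool (i = m)
       + (x $ m * (b * x $ i + (c + d * of_bool (i = j)) * x $ m)) * of_bool (j = m)
       + (a + b * of_bool (i = j)) * (x $ m)^2" for m
      unfolding s1 by (simp only: algebra_simps power2_eq_square)
    then show ?thesis
      by (simp only: sum.distrib D p1) (simp add: algebra_simps power2_eq_square)
  qed
  \<comment> \<open>The cubic sum \<open>p3\<close> appears here only with a coefficient free of
    \<open>i\<close>, so the outermost sum multiplies it by the coordinate sum and removes
    it.\<close>
  have s3: "(\<Sum>j\<in>UNIV. x $ j * (\<Sum>m\<in>UNIV. x $ m * (\<Sum>n\<in>UNIV. x $ n * N (card {i, j, m, n}))))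
    = 3 * b * p2 * x $ i + d * (x $ i)^3 + c * p3" for i
  proof -
    have "x $ j * (\<Sum>m\<in>UNIV. x $ m * (\<Sum>n\<in>UNIV. x $ n * N (card {i, j, m, n})))
      = (c * (x $ i)^2 + a * p2) * x $ j + (x $ j * (b * p2 + d * (x $ j)^2)) * of_bool (i = j)
        + (2 * b * x $ i) * (x $ j)^2 + c * (x $ j)^3" for j
      unfolding s2 by (simp only: algebra_simps power2_eq_square power3_eq_cube)
    then show ?thesis
      by (simp only: sum.distrib D p1) (simp add: algebra_simps power2_eq_square power3_eq_cube)
  qed
  have "(\<Sum>i\<in>UNIV. x $ i * (\<Sum>j\<in>UNIV. x $ j * (\<Sum>m\<in>UNIV. x $ m * (\<Sum>n\<in>UNIV. x $ n * N (card {i, j, m, n})))))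
    = (\<Sum>i\<in>UNIV. (3 * b * p2) * (x $ i)^2 + d * (x $ i)^4 + (c * p3) * x $ i)"
    unfolding s3 by (intro sum.cong refl) (simp only: algebra_simps power2_eq_square power3_eq_cube power4_eq_xxxx)
  also have "\<dots> = 3 * b * p2^2 + d * p4"
    by (simp only: sum.distrib p1) (simp add: power2_eq_square)
  also have "\<dots> = 3 * (N 2 - 2 * N 3 + N 4) * p2^2 + (N 1 - 7 * N 2 + 12 * N 3 - 6 * N 4) * p4"
    by (simp add: a_def b_def c_def d_def algebra_simps)
  finally show ?thesis
    by (simp only: p2_def p4_def mult.assoc sum_distrib_left)
qed

section \<open>The two configurations\<close>

definition two_valued :: "real \<Rightarrow> real \<Rightarrow> 8 set \<Rightarrow> real ^ 8" where
  "two_valued a b A = (\<chi> i. if i \<in> A then a else b)"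

text \<open>The roots e_i - e_j of A_7 up to scale, indexed by ordered pairs because both signs
  occur.\<close>

definition difference_vector :: "real \<Rightarrow> 8 \<times> 8 \<Rightarrow> real ^ 8" where
  "difference_vector a p = axis (fst p) a - axis (snd p) a"

lemma card_Compl_8: "card (- A) = 8 - card A" for A :: "8 set"
  by (simp add: Compl_eq_Diff_UNIV card_Diff_subset)

lemma two_valued_nth [simp]: "two_valued a b A $ i = (if i \<in> A then a else b)"
  by (simp add: two_valued_def)

lemma two_valued_fibres:
  assumes "a \<noteq> b"
  shows "{i. two_valued a b A $ i = a} = A" "{i. two_valued a b A $ i = b} = - A"
  using assms by auto

lemma inj_two_valued: "a \<noteq> b \<Longrightarrow> inj_on (two_valued a b) S"
proof (rule inj_onI)
  fix A B assume "a \<noteq> b" and eq: "two_valued a b A = two_valued a b B"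
  have "{i. two_valued a b A $ i = a} = {i. two_valued a b B $ i = a}" by (simp only: eq)
  then show "A = B" unfolding two_valued_fibres(1)[OF \<open>a \<noteq> b\<close>] .
qed

text \<open>The multiplicities add up to 8, so no coordinate is left for a third value.\<close>

lemma two_valued_image:
  assumes "a \<noteq> b" "k + l = 8"
  shows "{x :: real ^ 8. card {i. x $ i = a} = k \<and> card {i. x $ i = b} = l}
    = two_valued a b ` {A. card A = k}"
proof (intro equalityI subsetI)
  fix x :: "real ^ 8" assume "x \<in> {x. card {i. x $ i = a} = k \<and> card {i. x $ i = b} = l}"
  then have x: "card {i. x $ i = a} = k" "card {i. x $ i = b} = l" by auto
  define A where "A = {i. x $ i = a}"
  have "card (- A) = l" using x assms(2) unfolding card_Compl_8 A_def by simp
  then have "{i. x $ i = b} = - A"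
    using x(2) assms(1) by (intro card_subset_eq) (auto simp only: A_def finite)
  then have "x = two_valued a b A" by (auto simp: vec_eq_iff A_def)
  with x(1)[folded A_def] show "x \<in> two_valued a b ` {A. card A = k}" by blast
next
  fix x assume "x \<in> two_valued a b ` {A. card A = k}"
  then obtain A where A: "card A = k" "x = two_valued a b A" by blast
  have "card (- A) = l" using assms(2) A by (simp add: card_Compl_8)
  then show "x \<in> {x. card {i. x $ i = a} = k \<and> card {i. x $ i = b} = l}"
    unfolding A(2) mem_Collect_eq two_valued_fibres[OF assms(1)] using A(1) by simp
qed

lemma uminus_two_valued: "- two_valued a b A = two_valued (- a) (- b) A"
  by (simp add: vec_eq_iff)

lemma two_valued_Compl: "two_valued a b (- A) = two_valued b a A"
  by (simp add: vec_eq_iff)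

text \<open>A constant vector is orthogonal to \<open>x\<close>, so only the jump
  \<open>a - b\<close> is seen. This turns moments of the configurations into subset sums.\<close>

lemma inner_two_valued:
  assumes "(\<Sum>i\<in>UNIV. x $ i) = 0"
  shows "x \<bullet> two_valued a b A = (a - b) * (\<Sum>i\<in>A. x $ i)"
proof -
  have "x \<bullet> two_valued a b A = (\<Sum>i\<in>UNIV. (a - b) * (x $ i * of_bool (i \<in> A)) + b * x $ i)"
    unfolding inner_vec_def by (intro sum.cong refl) (auto simp: algebra_simps)
  then show ?thesis
    unfolding sum_as_indicator[of x A] using assms by (simp add: sum.distrib flip: sum_distrib_left)
qed

lemma inner_difference_vector: "x \<bullet> difference_vector a (i, j) = a * (x $ i - x $ j)"
  by (simp add: difference_vector_def inner_diff_right inner_axis algebra_simps)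

lemma difference_vector_nth:
  "difference_vector a (i, j) $ k = (if k = i then a else 0) - (if k = j then a else 0)"
  by (simp add: difference_vector_def axis_def)

lemma difference_vector_image:
  assumes "a > 0"
  shows "{x :: real ^ 8. card {i. x $ i = a} = 1 \<and> card {i. x $ i = - a} = 1 \<and> card {i. x $ i = 0} = 6}
    = difference_vector a ` {p. fst p \<noteq> snd p}"
proof (intro equalityI subsetI)
  fix x :: "real ^ 8" assume "x \<in> {x. card {i. x $ i = a} = 1 \<and> card {i. x $ i = - a} = 1 \<and> card {i. x $ i = 0} = 6}"
  then obtain i j where ij: "{i. x $ i = a} = {i}" "{i. x $ i = - a} = {j}" and z: "card {i. x $ i = 0} = 6"
    by (auto simp: card_1_singleton_iff)
  then have v: "x $ i = a" "x $ j = - a" by blast+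
  then have "i \<noteq> j" using assms by auto
  then have "card (- {i, j}) = 6" unfolding card_Compl_8 by simp
  moreover have "{i. x $ i = 0} \<subseteq> - {i, j}" using v assms by auto
  ultimately have "{i. x $ i = 0} = - {i, j}"
    using z by (intro card_subset_eq) simp_all
  then have "x = difference_vector a (i, j)"
    using v \<open>i \<noteq> j\<close> by (auto simp: vec_eq_iff difference_vector_nth)
  with \<open>i \<noteq> j\<close> show "x \<in> difference_vector a ` {p. fst p \<noteq> snd p}" by auto
next
  fix x assume "x \<in> difference_vector a ` {p. fst p \<noteq> snd p}"
  then obtain i j where x: "x = difference_vector a (i, j)" "i \<noteq> j" by auto
  have "{k. x $ k = a} = {i}" "{k. x $ k = - a} = {j}" "{k. x $ k = 0} = - {i, j}"
    using x assms by (auto simp: difference_vector_nth split: if_splits)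
  moreover have "card (- {i, j}) = 6" using x by (simp add: card_Compl_8)
  ultimately show "x \<in> {x. card {i. x $ i = a} = 1 \<and> card {i. x $ i = - a} = 1 \<and> card {i. x $ i = 0} = 6}"
    by simp
qed

lemma inj_difference_vector:
  assumes "a > 0"
  shows "inj_on (difference_vector a) {p. fst p \<noteq> snd p}"
proof (rule inj_onI, clarsimp)
  fix i j k l :: 8
  assume ne: "i \<noteq> j" "k \<noteq> l" and eq: "difference_vector a (i, j) = difference_vector a (k, l)"
  show "i = k \<and> j = l"
    using arg_cong[OF eq, of "\<lambda>v. v $ i"] arg_cong[OF eq, of "\<lambda>v. v $ j"] ne assms
    by (auto simp: difference_vector_nth split: if_splits)
qed

lemma omega56_eq:
  "omega56 = two_valued (- (3 / (2 * sqrt 6))) (1 / (2 * sqrt 6)) ` {A. card A = 2} \<union>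
     two_valued (3 / (2 * sqrt 6)) (- (1 / (2 * sqrt 6))) ` {A. card A = 2}"
proof -
  have "- (3 / (2 * sqrt 6)) \<noteq> 1 / (2 * sqrt 6)" "3 / (2 * sqrt 6) \<noteq> - (1 / (2 * sqrt 6))"
    by (simp_all add: field_simps)
  from two_valued_image[OF this(1), of 2 6] two_valued_image[OF this(2), of 2 6]
  show ?thesis unfolding omega56_def by simp
qed

lemma omega126_eq:
  "omega126 = difference_vector (1 / sqrt 2) ` {p. fst p \<noteq> snd p} \<union>
     two_valued (1 / (2 * sqrt 2)) (- (1 / (2 * sqrt 2))) ` {A. card A = 4}"
proof -
  have "1 / (2 * sqrt 2) \<noteq> - (1 / (2 * sqrt 2))" by simp
  then show ?thesis unfolding omega126_def by (subst difference_vector_image, simp, subst two_valued_image) auto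
qed

lemma sphere6_iff: "x \<in> sphere6 \<longleftrightarrow> (\<Sum>i\<in>UNIV. (x $ i)^2) = 1 \<and> (\<Sum>i\<in>UNIV. x $ i) = 0"
  by (simp add: sphere6_def norm_vec_def L2_set_def)

lemma sum_two_valued:
  "(\<Sum>i\<in>UNIV. g (two_valued a b A $ i)) = card A * g a + (8 - card A) * g b" for g :: "real \<Rightarrow> real"
proof -
  have "(\<Sum>i\<in>UNIV. g (two_valued a b A $ i)) = (\<Sum>i\<in>UNIV. if i \<in> A then g a else g b)"
    by (intro sum.cong) auto
  also have "\<dots> = card A * g a + card (- A) * g b"
    by (simp add: sum.If_cases Compl_eq)
  finally show ?thesis using card_mono[of UNIV A] by (simp add: card_Compl_8 of_nat_diff)
qed

lemma omega56_subset: "omega56 \<subseteq> sphere6"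
proof -
  have "two_valued (- (3 / (2 * sqrt 6))) (1 / (2 * sqrt 6)) A \<in> sphere6"
    "two_valued (3 / (2 * sqrt 6)) (- (1 / (2 * sqrt 6))) A \<in> sphere6" if "card A = 2" for A
    unfolding sphere6_iff sum_two_valued[where g = "\<lambda>t. t^2"] sum_two_valued[where g = "\<lambda>t. t"] that
    by (simp_all add: power_divide power_mult_distrib)
  then show ?thesis unfolding omega56_eq by auto
qed

lemma omega126_subset: "omega126 \<subseteq> sphere6"
proof -
  have "two_valued (1 / (2 * sqrt 2)) (- (1 / (2 * sqrt 2))) A \<in> sphere6" if "card A = 4" for A
    unfolding sphere6_iff sum_two_valued[where g = "\<lambda>t. t^2"] sum_two_valued[where g = "\<lambda>t. t"] that
    by (simp_all add: power_divide power_mult_distrib)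
  moreover have "difference_vector (1 / sqrt 2) (i, j) \<in> sphere6" if "i \<noteq> j" for i j
  proof -
    have "(difference_vector (1 / sqrt 2) (i, j) $ k)^2 = (if k = i then 1/2 else 0) + (if k = j then 1/2 else 0)" for k
      using that by (auto simp: difference_vector_nth power_divide)
    then show ?thesis
      by (simp add: sphere6_iff sum.distrib) (simp add: difference_vector_nth sum_subtractf)
  qed
  ultimately show ?thesis unfolding omega126_eq by auto
qed

lemma uminus_omega56: "uminus ` omega56 = omega56"
  by (simp add: omega56_eq image_Un image_image uminus_two_valued Un_commute)

text \<open>Negation swaps the indices of a difference vector and complements a 4-set, whose
  complement is again a 4-set.\<close>

lemma uminus_omega126: "uminus ` omega126 = omega126"
proof -
  have "- two_valued a (- a) A = two_valued a (- a) (- A)" for a A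
    by (simp add: uminus_two_valued two_valued_Compl)
  moreover have "- difference_vector a (i, j) = difference_vector a (j, i)" for a i j
    by (simp add: difference_vector_def)
  ultimately have sub: "uminus ` omega126 \<subseteq> omega126"
    unfolding omega126_eq by (fastforce simp: card_Compl_8)
  have "x \<in> uminus ` omega126" if "x \<in> omega126" for x
    using sub that by (intro image_eqI[of x uminus "- x"]) auto
  with sub show ?thesis by blast
qed

section \<open>Second and fourth moments of the two configurations\<close>

lemma num_supersets_values:
  "num_supersets 2 1 = 7" "num_supersets 2 2 = 1" "num_supersets 2 3 = 0" "num_supersets 2 4 = 0"
  "num_supersets 4 1 = 35" "num_supersets 4 2 = 15" "num_supersets 4 3 = 5" "num_supersets 4 4 = 1"
  by (simp_all add: num_supersets_def binomial_fact fact_numeral)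

text \<open>For pairs the coefficient 7 - 7 * 1 of the fourth power sum vanishes, so the result does
  not depend on \<open>x\<close>.\<close>

lemma pair_sums:
  assumes "x \<in> sphere6"
  shows "(\<Sum>A | card A = 2. (\<Sum>i\<in>A. x $ i)^2) = 6"
    "(\<Sum>A | card A = 2. (\<Sum>i\<in>A. x $ i)^4) = 3"
proof -
  have p: "(\<Sum>i\<in>UNIV. x $ i) = 0" "(\<Sum>i\<in>UNIV. (x $ i)^2) = 1"
    using assms by (simp_all add: sphere6_iff)
  show "(\<Sum>A | card A = 2. (\<Sum>i\<in>A. x $ i)^2) = 6"
    unfolding subset_sum_square pattern_sum_square[OF p(1)] p num_supersets_values by simp
  show "(\<Sum>A | card A = 2. (\<Sum>i\<in>A. x $ i)^4) = 3"
    unfolding subset_sum_fourth pattern_sum_fourth[OF p(1)] p num_supersets_values by simp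
qed

lemma quadruple_sums:
  assumes "x \<in> sphere6"
  shows "(\<Sum>A | card A = 4. (\<Sum>i\<in>A. x $ i)^2) = 20"
    "(\<Sum>A | card A = 4. (\<Sum>i\<in>A. x $ i)^4) = 18 - 16 * (\<Sum>i\<in>UNIV. (x $ i)^4)"
proof -
  have p: "(\<Sum>i\<in>UNIV. x $ i) = 0" "(\<Sum>i\<in>UNIV. (x $ i)^2) = 1"
    using assms by (simp_all add: sphere6_iff)
  show "(\<Sum>A | card A = 4. (\<Sum>i\<in>A. x $ i)^2) = 20"
    unfolding subset_sum_square pattern_sum_square[OF p(1)] p num_supersets_values by simp
  show "(\<Sum>A | card A = 4. (\<Sum>i\<in>A. x $ i)^4) = 18 - 16 * (\<Sum>i\<in>UNIV. (x $ i)^4)"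
    unfolding subset_sum_fourth pattern_sum_fourth[OF p(1)] p num_supersets_values by simp
qed

lemma difference_sums:
  assumes "x \<in> sphere6"
  shows "(\<Sum>p | fst p \<noteq> snd p. (x $ fst p - x $ snd p)^2) = 16"
    "(\<Sum>p | fst p \<noteq> snd p. (x $ fst p - x $ snd p)^4) = 16 * (\<Sum>i\<in>UNIV. (x $ i)^4) + 6"
proof -
  have p: "(\<Sum>i\<in>UNIV. x $ i) = 0" "(\<Sum>i\<in>UNIV. (x $ i)^2) = 1"
    using assms by (simp_all add: sphere6_iff)
  have all: "(\<Sum>p | fst p \<noteq> snd p. (x $ fst p - x $ snd p)^k) = (\<Sum>i\<in>UNIV. \<Sum>j\<in>UNIV. (x $ i - x $ j)^k)"
    if "k > 0" for k
  proof -
    have "(\<Sum>p | fst p \<noteq> snd p. (x $ fst p - x $ snd p)^k) = (\<Sum>p\<in>UNIV. (x $ fst p - x $ snd p)^k)"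
      by (rule sum.mono_neutral_left) (use that in auto)
    then show ?thesis by (simp add: sum.cartesian_product UNIV_Times_UNIV split_def)
  qed
  have "(x $ i - x $ j)^2 = (x $ i)^2 + (x $ j)^2 - (2 * x $ i) * x $ j" for i j
    by (simp add: power2_diff)
  then show "(\<Sum>p | fst p \<noteq> snd p. (x $ fst p - x $ snd p)^2) = 16"
    unfolding all[OF zero_less_numeral] by (simp add: sum.distrib sum_subtractf p flip: sum_distrib_left)
  have "(x $ i - x $ j)^4 = (x $ i)^4 + (x $ j)^4 + (6 * (x $ i)^2) * (x $ j)^2
      - (4 * (x $ i)^3) * x $ j - (4 * x $ i) * (x $ j)^3" for i j
    by algebra
  then have inner: "(\<Sum>j\<in>UNIV. (x $ i - x $ j)^4)
    = 8 * (x $ i)^4 + (\<Sum>j\<in>UNIV. (x $ j)^4) + 6 * (x $ i)^2 - (4 * (\<Sum>j\<in>UNIV. (x $ j)^3)) * x $ i" for i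
    by (simp add: sum.distrib sum_subtractf p flip: sum_distrib_left)
  show "(\<Sum>p | fst p \<noteq> snd p. (x $ fst p - x $ snd p)^4) = 16 * (\<Sum>i\<in>UNIV. (x $ i)^4) + 6"
    unfolding all[OF zero_less_numeral] inner
    by (simp add: sum.distrib sum_subtractf p flip: sum_distrib_left)
qed

lemma sqrt6: "sqrt 6 = sqrt 2 * sqrt 3"
  by (simp flip: real_sqrt_mult)

lemma inner_omega56:
  assumes "x \<in> sphere6"
  shows "x \<bullet> two_valued (- (3 / (2 * sqrt 6))) (1 / (2 * sqrt 6)) A = - (2 / sqrt 6) * (\<Sum>i\<in>A. x $ i)"
    "x \<bullet> two_valued (3 / (2 * sqrt 6)) (- (1 / (2 * sqrt 6))) A = (2 / sqrt 6) * (\<Sum>i\<in>A. x $ i)"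
  using assms by (simp_all add: sphere6_iff inner_two_valued field_simps)

lemma inner_omega126:
  assumes "x \<in> sphere6"
  shows "x \<bullet> two_valued (1 / (2 * sqrt 2)) (- (1 / (2 * sqrt 2))) A = (1 / sqrt 2) * (\<Sum>i\<in>A. x $ i)"
  using assms by (simp add: sphere6_iff inner_two_valued)

lemma finite_omega56: "finite omega56"
  by (simp add: omega56_eq)

lemma finite_omega126: "finite omega126"
  by (simp add: omega126_eq)

lemma sum_omega56:
  fixes F :: "real ^ 8 \<Rightarrow> real"
  shows "(\<Sum>y\<in>omega56. F y) = (\<Sum>A | card A = 2. F (two_valued (- (3 / (2 * sqrt 6))) (1 / (2 * sqrt 6)) A))
    + (\<Sum>A | card A = 2. F (two_valued (3 / (2 * sqrt 6)) (- (1 / (2 * sqrt 6))) A))"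
proof -
  have three: "3 / (2 * sqrt 6) = 3 * (1 / (2 * sqrt 6))" by simp
  define c where "c = 1 / (2 * sqrt 6)"
  have "two_valued (- (3 * c)) c ` {A. card A = 2} \<inter> two_valued (3 * c) (- c) ` {A. card A = 2} = {}"
  proof (rule ccontr)
    assume "\<not> ?thesis"
    then obtain A B :: "8 set" where AB: "card A = 2" "card B = 2" "two_valued (- (3 * c)) c A = two_valued (3 * c) (- c) B"
      by blast
    \<comment> \<open>The value \<open>c\<close> is taken exactly on \<open>- A\<close> on the left
      and nowhere on the right, where the values are \<open>3 * c\<close> and
      \<open>- c\<close>.\<close>
    then have "{i. two_valued (- (3 * c)) c A $ i = c} = {i. two_valued (3 * c) (- c) B $ i = c}" by simp
    moreover have "c > 0" by (simp add: c_def)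
    ultimately have "- A = {}" using two_valued_fibres(2)[of "- (3 * c)" c A] by (auto split: if_splits)
    then have "card (- A) = 0" by simp
    with AB(1) show False by (simp add: card_Compl_8)
  qed
  moreover have "c > 0" by (simp add: c_def)
  ultimately show ?thesis
    unfolding omega56_eq three c_def[symmetric]
    by (subst sum.union_disjoint) (simp_all add: sum.reindex inj_two_valued)
qed

lemma sum_omega126:
  fixes F :: "real ^ 8 \<Rightarrow> real"
  shows "(\<Sum>y\<in>omega126. F y) = (\<Sum>p | fst p \<noteq> snd p. F (difference_vector (1 / sqrt 2) p))
    + (\<Sum>A | card A = 4. F (two_valued (1 / (2 * sqrt 2)) (- (1 / (2 * sqrt 2))) A))"
proof -
  have "difference_vector (1 / sqrt 2) p \<noteq> two_valued (1 / (2 * sqrt 2)) (- (1 / (2 * sqrt 2))) A"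
    if "fst p \<noteq> snd p" for p A
  proof
    assume "difference_vector (1 / sqrt 2) p = two_valued (1 / (2 * sqrt 2)) (- (1 / (2 * sqrt 2))) A"
    \<comment> \<open>At the index \<open>fst p\<close> the left side is 1/sqrt 2, while every
      coordinate on the right has modulus half of that.\<close>
    from arg_cong[OF this, of "\<lambda>v. v $ fst p"] show False
      using that by (cases p) (auto simp: difference_vector_nth field_simps split: if_splits)
  qed
  then have "difference_vector (1 / sqrt 2) ` {p. fst p \<noteq> snd p} \<inter>
     two_valued (1 / (2 * sqrt 2)) (- (1 / (2 * sqrt 2))) ` {A. card A = 4} = {}"
    by auto
  then show ?thesis
    unfolding omega126_eq
    by (subst sum.union_disjoint) (simp_all add: sum.reindex inj_two_valued inj_difference_vector)
qed

lemma omega56_moments: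
  assumes "x \<in> sphere6"
  shows "(\<Sum>y\<in>omega56. (x \<bullet> y)^2) = 3 * (8 / 3)" "(\<Sum>y\<in>omega56. (x \<bullet> y)^4) = 8 / 3"
proof -
  have s6: "sqrt 6 ^ 4 = 36" by (simp add: power4_eq_xxxx)
  show "(\<Sum>y\<in>omega56. (x \<bullet> y)^2) = 3 * (8 / 3)" "(\<Sum>y\<in>omega56. (x \<bullet> y)^4) = 8 / 3"
    unfolding sum_omega56 inner_omega56[OF assms] power_mult_distrib sum_distrib_left[symmetric] pair_sums[OF assms]
    by (simp_all add: power_divide s6)
qed

text \<open>Neither family alone has a constant fourth moment: the difference vectors contribute +16
  and the quadruples -16 times the sum of the x_i^4. Both carry the same factor 1/sqrt 2, so the
  terms cancel.\<close>

lemma omega126_moments: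
  assumes "x \<in> sphere6"
  shows "(\<Sum>y\<in>omega126. (x \<bullet> y)^2) = 3 * 6" "(\<Sum>y\<in>omega126. (x \<bullet> y)^4) = 6"
proof -
  have s2: "sqrt 2 ^ 4 = 4" by (simp add: power4_eq_xxxx)
  have inner: "x \<bullet> difference_vector (1 / sqrt 2) p = (1 / sqrt 2) * (x $ fst p - x $ snd p)" for p
    by (cases p) (simp add: inner_difference_vector)
  show "(\<Sum>y\<in>omega126. (x \<bullet> y)^2) = 3 * 6" "(\<Sum>y\<in>omega126. (x \<bullet> y)^4) = 6"
    unfolding sum_omega126 inner inner_omega126[OF assms] power_mult_distrib sum_distrib_left[symmetric]
      difference_sums[OF assms] quadruple_sums[OF assms]
    by (simp_all add: power_divide s2 add_divide_distrib diff_divide_distrib)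
qed

section \<open>Inner products between the configurations, and recovery of each from the
  other\<close>

lemma scaled_dots: "t * (1 / sqrt 3) \<in> dots \<longleftrightarrow> t \<in> {0, 1, -1}"
proof -
  have "t * r = - r \<longleftrightarrow> t = -1" if "r \<noteq> 0" for r :: real
    using mult_cancel_right[of t r "-1"] that by simp
  from this[of "1 / sqrt 3"] show ?thesis by auto
qed

lemma two_div_sqrt6: "2 / sqrt 6 = sqrt 2 * (1 / sqrt 3)"
  by (simp add: sqrt6 real_div_sqrt flip: divide_divide_eq_left)

lemma ex_outside:
  fixes S :: "8 set"
  assumes "card S < 8"
  obtains j where "j \<notin> S"
proof -
  have "S \<noteq> UNIV" using assms by auto
  then show ?thesis using that by blast
qed

text \<open>Scaled by sqrt 2, the coordinates of \<open>x\<close> are all 1/2 up to sign, or are 1,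
  -1 and zeros with 1 and -1 occurring once each. Two coordinates at distinct places therefore add
  up to 0, 1 or -1.\<close>

lemma inner_omega126_omega56:
  assumes "x \<in> omega126" "y \<in> omega56"
  shows "x \<bullet> y \<in> dots"
proof -
  have x: "x \<in> sphere6" using assms omega126_subset by blast
  obtain A where A: "card A = 2" and xy: "x \<bullet> y = 2 / sqrt 6 * (\<Sum>i\<in>A. x $ i) \<or> x \<bullet> y = - (2 / sqrt 6 * (\<Sum>i\<in>A. x $ i))"
    using assms(2) inner_omega56[OF x] unfolding omega56_eq by auto
  obtain k l where kl: "A = {k, l}" "k \<noteq> l" using A by (auto simp: card_2_iff)
  have "sqrt 2 * (x $ k + x $ l) \<in> {0, 1, -1}"
  proof -
    from assms(1) consider a b where "a \<noteq> b" "x = difference_vector (1 / sqrt 2) (a, b)"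
      | B where "x = two_valued (1 / (2 * sqrt 2)) (- (1 / (2 * sqrt 2))) B"
      unfolding omega126_eq by auto
    then show ?thesis
    proof cases
      case 1
      then have "sqrt 2 * x $ i = of_bool (i = a) - of_bool (i = b)" for i
        by (simp add: difference_vector_nth)
      with 1(1) kl(2) show ?thesis by (auto simp: distrib_left)
    next
      case 2
      then have "sqrt 2 * x $ i = (if i \<in> B then 1 / 2 else - 1 / 2)" for i by simp
      then show ?thesis by (simp add: distrib_left)
    qed
  qed
  then have "sqrt 2 * (\<Sum>i\<in>A. x $ i) * (1 / sqrt 3) \<in> dots"
    unfolding scaled_dots using kl by simp
  then have "2 / sqrt 6 * (\<Sum>i\<in>A. x $ i) \<in> dots"
    unfolding two_div_sqrt6 by (simp only: mult_ac)
  with xy show ?thesis by auto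
qed

lemma omega126_characterization:
  assumes x: "x \<in> sphere6" and dots: "\<And>y. y \<in> omega56 \<Longrightarrow> x \<bullet> y \<in> dots"
  shows "x \<in> omega126"
proof -
  define u where "u i = sqrt 2 * x $ i" for i
  have xu: "x $ i = u i / sqrt 2" for i by (simp add: u_def)
  have pair: "u i + u j \<in> {0, 1, -1}" if "i \<noteq> j" for i j
  proof -
    have "two_valued (3 / (2 * sqrt 6)) (- (1 / (2 * sqrt 6))) {i, j} \<in> omega56"
      using that by (auto simp: omega56_eq)
    from dots[OF this] have "2 / sqrt 6 * (\<Sum>k\<in>{i, j}. x $ k) \<in> dots"
      by (simp only: inner_omega56[OF x])
    moreover have "2 / sqrt 6 * (\<Sum>k\<in>{i, j}. x $ k) = (u i + u j) * (1 / sqrt 3)"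
      unfolding two_div_sqrt6 using that by (simp add: u_def algebra_simps add_divide_distrib)
    ultimately have "(u i + u j) * (1 / sqrt 3) \<in> dots" by (simp only:)
    then show ?thesis unfolding scaled_dots .
  qed
  have sum0: "(\<Sum>i\<in>UNIV. u i) = 0"
    using x by (simp add: u_def sphere6_iff flip: sum_distrib_left)
  have sum2: "(\<Sum>i\<in>UNIV. (u i)^2) = 2"
    using x by (simp add: u_def sphere6_iff power_mult_distrib flip: sum_distrib_left)
  \<comment> \<open>Twice \<open>u i\<close> is a signed sum of three pair sums, hence an integer of
    modulus at most 3.\<close>
  have half: "u i \<in> {0, 1, -1} \<or> \<bar>u i\<bar> = 1/2 \<or> \<bar>u i\<bar> = 3/2" for i
  proof -
    obtain j where j: "j \<notin> {i}" by (rule ex_outside[of "{i}"]) simp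
    obtain k where k: "k \<notin> {i, j}" by (rule ex_outside[of "{i, j}"]) (simp add: card_insert_if)
    have "2 * u i = (u i + u j) + (u i + u k) - (u j + u k)" by simp
    then show ?thesis
      using pair[of i j] pair[of i k] pair[of j k] j k by auto
  qed
  \<comment> \<open>A single coordinate 3/2 would contribute 9/4 to a sum of squares equal to
    2.\<close>
  have no32: "\<bar>u i\<bar> \<noteq> 3/2" for i
  proof
    assume "\<bar>u i\<bar> = 3/2"
    then have "\<bar>u i\<bar>^2 = (3/2)^2" by (rule arg_cong)
    then have "(u i)^2 = 9/4" by (simp add: power_divide)
    moreover have "(u i)^2 \<le> (\<Sum>i\<in>UNIV. (u i)^2)" by (rule member_le_sum) auto
    ultimately show False using sum2 by simp
  qed
  show ?thesis
  proof (cases "\<exists>i. \<bar>u i\<bar> = 1/2")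
    case True
    then obtain i where i: "\<bar>u i\<bar> = 1/2" by blast
    \<comment> \<open>Pair sums are integers, so one half-integral coordinate forces all the others
      to be half-integral.\<close>
    have all: "\<bar>u j\<bar> = 1/2" for j
      using pair[of i j] half[of j] no32[of j] i by (cases "i = j") (auto simp: abs_if split: if_splits)
    define A where "A = {i. u i = 1/2}"
    have x_eq: "x = two_valued (1 / (2 * sqrt 2)) (- (1 / (2 * sqrt 2))) A"
    proof -
      have "u j = (if j \<in> A then 1 / 2 else - 1 / 2)" for j
        using all[of j] by (auto simp: A_def)
      then show ?thesis by (simp add: vec_eq_iff xu)
    qed
    have "(\<Sum>i\<in>UNIV. x $ i) = 0" using x by (simp add: sphere6_iff)
    then have "card A = 4"
      unfolding x_eq sum_two_valued[where g = "\<lambda>t. t"] by (simp add: field_simps)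
    then show ?thesis unfolding x_eq omega126_eq by blast
  next
    case False
    then have u: "u i \<in> {0, 1, -1}" for i using half no32 by blast
    define P where "P = {i. u i = 1}"
    define M where "M = {i. u i = -1}"
    have PM: "P \<inter> M = {}" by (auto simp: P_def M_def)
    have "u i = of_bool (i \<in> P) - of_bool (i \<in> M)" "(u i)^2 = of_bool (i \<in> P) + of_bool (i \<in> M)" for i
      using u[of i] by (auto simp: P_def M_def)
    \<comment> \<open>The zero sum balances the entries 1 and -1, and the squared norm 2 counts
      them.\<close>
    then have "real (card P) = real (card M)" "real (card P) + real (card M) = 2"
      using sum0 sum2 by (simp_all add: sum.distrib sum_subtractf)
    then have c: "card P = 1" "card M = 1" by simp_all
    have "{i. u i = 0} = - (P \<union> M)" using u by (auto simp: P_def M_def)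
    moreover have "card (P \<union> M) = 2" using c PM by (subst card_Un_disjoint) auto
    ultimately have "card {i. u i = 0} = 6" by (simp only: card_Compl_8)
    moreover have "x $ i = 1 / sqrt 2 \<longleftrightarrow> u i = 1" "x $ i = - (1 / sqrt 2) \<longleftrightarrow> u i = -1" "x $ i = 0 \<longleftrightarrow> u i = 0" for i
      by (auto simp: u_def field_simps)
    ultimately show ?thesis using c by (simp add: omega126_def P_def M_def)
  qed
qed

lemma omega56_characterization:
  assumes x: "x \<in> sphere6" and dots: "\<And>y. y \<in> omega126 \<Longrightarrow> x \<bullet> y \<in> dots"
  shows "x \<in> omega56"
proof -
  \<comment> \<open>This scale satisfies c / sqrt 2 = 1 / sqrt 3, so differences of rescaled
    coordinates become 0, 1 or -1.\<close>
  define c where "c = 2 / sqrt 6"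
  have c0: "c > 0" and c2: "c^2 = 2/3" by (simp_all add: c_def power_divide)
  define v where "v i = x $ i / c" for i
  have xv: "x $ i = c * v i" for i using c0 by (simp add: v_def)
  have diff: "v i - v j \<in> {0, 1, -1}" for i j
  proof (cases "i = j")
    case False
    then have "difference_vector (1 / sqrt 2) (i, j) \<in> omega126"
      by (auto simp: omega126_eq)
    from dots[OF this] have "1 / sqrt 2 * (x $ i - x $ j) \<in> dots"
      by (simp only: inner_difference_vector)
    moreover have "1 / sqrt 2 * (x $ i - x $ j) = (v i - v j) * (1 / sqrt 3)"
    proof -
      have "1 / sqrt 2 * (x $ i - x $ j) = (v i - v j) * (1 / sqrt 2 * c)"
        by (simp add: xv algebra_simps diff_divide_distrib)
      also have "1 / sqrt 2 * c = 1 / sqrt 3" by (simp add: c_def two_div_sqrt6)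
      finally show ?thesis .
    qed
    ultimately have "(v i - v j) * (1 / sqrt 3) \<in> dots" by (simp only:)
    then show ?thesis unfolding scaled_dots .
  qed simp
  \<comment> \<open>Measured from the minimal coordinate, differences can only be 0 or 1, so
    \<open>v\<close> takes at most the two values \<open>m\<close> and \<open>m + 1\<close>.\<close>
  have "Min (range v) \<in> range v" by (rule Min_in) auto
  then obtain k where k: "Min (range v) = v k" by blast
  define m where "m = v k"
  have m: "m \<le> v j" for j unfolding m_def k[symmetric] by simp
  define K where "K = {i. v i = m + 1}"
  have vK: "v i = m + of_bool (i \<in> K)" for i
    using diff[of i k] m[of i] by (auto simp: K_def m_def)
  have "(\<Sum>i\<in>UNIV. v i) = 0" using x by (simp add: v_def sphere6_iff flip: sum_divide_distrib)
  then have s1: "8 * m + real (card K) = 0" by (simp add: vK sum.distrib)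
  have "(\<Sum>i\<in>UNIV. (v i)^2) = 3/2"
  proof -
    have "(v i)^2 = 3/2 * (x $ i)^2" for i by (simp add: v_def power_divide c2)
    then have "(\<Sum>i\<in>UNIV. (v i)^2) = 3/2 * (\<Sum>i\<in>UNIV. (x $ i)^2)"
      by (simp only: sum_distrib_left)
    then show ?thesis using x by (simp add: sphere6_iff)
  qed
  moreover have "(v i)^2 = m^2 + (2 * m + 1) * of_bool (i \<in> K)" for i
    by (simp add: vK power2_eq_square algebra_simps)
  ultimately have s2: "8 * m^2 + (2 * m + 1) * real (card K) = 3/2"
    by (simp add: sum.distrib flip: sum_distrib_left)
  have vm: "m = - real (card K) / 8" using s1 by simp
  \<comment> \<open>With n = \<open>card K\<close> and m = -n/8 the norm condition becomes n - n^2/8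
    = 3/2. The roots 2 and 6 give the two halves of \<open>omega56\<close>.\<close>
  have "(real (card K) - 2) * (real (card K) - 6) = 0"
    using s2 unfolding vm by (simp add: power2_eq_square field_simps)
  then have "card K = 2 \<or> card K = 6" by auto
  then show ?thesis
  proof
    assume K: "card K = 2"
    have "x = two_valued (3 / (2 * sqrt 6)) (- (1 / (2 * sqrt 6))) K"
      unfolding vec_eq_iff by (simp add: xv vK vm K c_def)
    then show ?thesis using K by (auto simp: omega56_eq)
  next
    assume K: "card K = 6"
    have "x = two_valued (- (3 / (2 * sqrt 6))) (1 / (2 * sqrt 6)) (- K)"
      unfolding vec_eq_iff by (simp add: xv vK vm K c_def)
    moreover have "card (- K) = 2" using K by (simp add: card_Compl_8)
    ultimately show ?thesis by (auto simp: omega56_eq)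
  qed
qed

lemma omega_nonempty: "omega56 \<noteq> {}" "omega126 \<noteq> {}"
proof -
  have "\<exists>A :: 8 set. card A = k" if "k \<le> 8" for k
    by (rule obtain_subset_with_card_n[of k "UNIV :: 8 set"]) (use that in auto)
  from this[of 2] this[of 4] show "omega56 \<noteq> {}" "omega126 \<noteq> {}"
    by (simp_all add: omega56_eq omega126_eq)
qed

theorem theorem10p3:
  fixes f :: "real \<Rightarrow> ereal"
  assumes "admissible f"
  shows "(\<forall>x\<in>omega126. is_arg_min (potential f omega56) (\<lambda>y. y \<in> sphere6) x) \<and>
         (\<forall>x\<in>omega56. is_arg_min (potential f omega126) (\<lambda>y. y \<in> sphere6) x) \<and>
         (strictly_convex_on {0<..<4} (iter_deriv f 4) \<longrightarrow>
            (\<forall>x. is_arg_min (potential f omega56) (\<lambda>y. y \<in> sphere6) x \<longrightarrow> x \<in> omega126) \<and>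
            (\<forall>x. is_arg_min (potential f omega126) (\<lambda>y. y \<in> sphere6) x \<longrightarrow> x \<in> omega56))"
proof -
  obtain C where C:
    "\<forall>x\<in>sphere6. ereal C \<le> potential f omega56 x"
    "\<forall>x\<in>sphere6. (\<forall>y\<in>omega56. x \<bullet> y \<in> dots) \<longrightarrow> potential f omega56 x = ereal C"
    "strictly_convex_on {0<..<4} (iter_deriv f 4) \<longrightarrow>
       (\<forall>x\<in>sphere6. potential f omega56 x = ereal C \<longrightarrow> (\<forall>y\<in>omega56. x \<bullet> y \<in> dots))"
    by (rule potential_on_design[OF assms finite_omega56 omega56_subset uminus_omega56 omega56_moments])
  obtain C' where C':
    "\<forall>x\<in>sphere6. ereal C' \<le> potential f omega126 x"
    "\<forall>x\<in>sphere6. (\<forall>y\<in>omega126. x \<bullet> y \<in> dots) \<longrightarrow> potential f omega126 x = ereal C'"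
    "strictly_convex_on {0<..<4} (iter_deriv f 4) \<longrightarrow>
       (\<forall>x\<in>sphere6. potential f omega126 x = ereal C' \<longrightarrow> (\<forall>y\<in>omega126. x \<bullet> y \<in> dots))"
    by (rule potential_on_design[OF assms finite_omega126 omega126_subset uminus_omega126 omega126_moments])
  have val: "x \<in> sphere6" "potential f omega56 x = ereal C" if "x \<in> omega126" for x
    using that omega126_subset inner_omega126_omega56 C(2) by blast+
  have val': "x \<in> sphere6" "potential f omega126 x = ereal C'" if "x \<in> omega56" for x
  proof -
    show x: "x \<in> sphere6" using that omega56_subset by blast
    have "\<forall>y\<in>omega126. x \<bullet> y \<in> dots"
      using that inner_omega126_omega56[of _ x] by (simp only: inner_commute) blast
    with x show "potential f omega126 x = ereal C'" using C'(2) by blast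
  qed
  \<comment> \<open>Witnesses that the lower bounds are attained; without them a minimizer could not
    be compared with \<open>C\<close> and \<open>C'\<close>.\<close>
  obtain x0 x1 where x01: "x0 \<in> omega126" "x1 \<in> omega56"
    using omega_nonempty by blast
  have "is_arg_min (potential f omega56) (\<lambda>y. y \<in> sphere6) x" if "x \<in> omega126" for x
    using val[OF that] C(1) by (simp add: is_arg_min_linorder)
  moreover have "is_arg_min (potential f omega126) (\<lambda>y. y \<in> sphere6) x" if "x \<in> omega56" for x
    using val'[OF that] C'(1) by (simp add: is_arg_min_linorder)
  moreover have "x \<in> omega126" if "strictly_convex_on {0<..<4} (iter_deriv f 4)"
    and "is_arg_min (potential f omega56) (\<lambda>y. y \<in> sphere6) x" for x
  proof -
    have x: "x \<in> sphere6" "potential f omega56 x \<le> ereal C"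
      using that(2) val[OF x01(1)] by (auto simp: is_arg_min_linorder)
    then have "potential f omega56 x = ereal C" using C(1) by (simp add: antisym)
    then show ?thesis using C(3) that(1) x(1) by (intro omega126_characterization) blast+
  qed
  moreover have "x \<in> omega56" if "strictly_convex_on {0<..<4} (iter_deriv f 4)"
    and "is_arg_min (potential f omega126) (\<lambda>y. y \<in> sphere6) x" for x
  proof -
    have x: "x \<in> sphere6" "potential f omega126 x \<le> ereal C'"
      using that(2) val'[OF x01(2)] by (auto simp: is_arg_min_linorder)
    then have "potential f omega126 x = ereal C'" using C'(1) by (simp add: antisym)
    then show ?thesis using C'(3) that(1) x(1) by (intro omega56_characterization) blast+
  qed
  ultimately show ?thesis by blast
qed

end
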